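(* For all binary strings $x,y$, $$-\log \mathbf{e}(x,y)=\max(\mathrm{KP}(x\mid y),\mathrm{KP}(y\mid x))+O(1),$$ where the $O(1)$ term is bounded by a constant independent of $x,y$.
   Context: A computable partial function $U(p,x)$ of two binary-string arguments is prefix-free if for every $x$ the set of $p$ with $U(p,x)$ defined contains no string together with a proper prefix of it. For an infinite binary sequence $\pi$, write $U(\pi,x)=y$ if $U(p,x)=y$ for some finite prefix $p$ of $\pi$. Define $e_U(x,y)=\Pr_\pi[U(\pi,x)=y \text{ and } U(\pi,y)=x]$, where $\pi$ is a uniformly random infinite binary sequence (the prefixes used for the two computations may differ). There is a prefix-free $U$ making $e_U$ maximal up to a constant factor among all prefix-free computable partial functions; $\mathbf{e}$ denotes $e_U$ for such an optimal $U$. $\mathrm{KP}(y\mid x)$ is conditional prefix complexity: $\min\{|p|: V(p,x)=y\}$ for an optimal prefix-free computable partial $V$. Logarithms are base 2. *)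

theory Defs
  imports "HOL-Probability.Probability" "HOL-Library.Sublist"
begin

datatype recf = Z | S | Id nat | Cn recf "recf list" | Pr recf recf | Mn recf

inductive eval :: "recf \<Rightarrow> nat list \<Rightarrow> nat \<Rightarrow> bool" where
  eval_Z: "eval Z xs 0"
| eval_S: "eval S (x # xs) (Suc x)"
| eval_Id: "i < length xs \<Longrightarrow> eval (Id i) xs (xs ! i)"
| eval_Cn: "list_all2 (\<lambda>g y. eval g xs y) gs ys \<Longrightarrow> eval f ys z \<Longrightarrow> eval (Cn f gs) xs z"
| eval_Pr0: "eval g xs y \<Longrightarrow> eval (Pr g h) (0 # xs) y"
| eval_PrS: "eval (Pr g h) (k # xs) y \<Longrightarrow> eval h (k # y # xs) z \<Longrightarrow> eval (Pr g h) (Suc k # xs) z"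
| eval_Mn: "eval f (k # xs) 0 \<Longrightarrow> (\<forall>i<k. \<exists>y. eval f (i # xs) y \<and> y > 0) \<Longrightarrow> eval (Mn f) xs k"

text \<open>Bijective encoding of binary strings as natural numbers.\<close>
fun enc :: "bool list \<Rightarrow> nat" where
  "enc [] = 0"
| "enc (b # bs) = (if b then 2 else 1) + 2 * enc bs"

definition computable2 :: "(bool list \<Rightarrow> bool list \<Rightarrow> bool list option) \<Rightarrow> bool" where
  "computable2 U \<longleftrightarrow> (\<exists>f. \<forall>p x y. U p x = Some y \<longleftrightarrow> eval f [enc p, enc x] (enc y))"

definition prefix_free2 :: "(bool list \<Rightarrow> bool list \<Rightarrow> bool list option) \<Rightarrow> bool" where
  "prefix_free2 U \<longleftrightarrow> (\<forall>x p q. U p x \<noteq> None \<and> U q x \<noteq> None \<longrightarrow> \<not> strict_prefix p q)"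

definition cantor :: "(nat \<Rightarrow> bool) measure" where
  "cantor = PiM UNIV (\<lambda>_::nat. measure_pmf (bernoulli_pmf (1/2)))"

definition runs :: "(bool list \<Rightarrow> bool list \<Rightarrow> bool list option) \<Rightarrow> (nat \<Rightarrow> bool) \<Rightarrow> bool list \<Rightarrow> bool list \<Rightarrow> bool" where
  "runs U \<pi> x y \<longleftrightarrow> (\<exists>n. U (map \<pi> [0..<n]) x = Some y)"

definition eprob :: "(bool list \<Rightarrow> bool list \<Rightarrow> bool list option) \<Rightarrow> bool list \<Rightarrow> bool list \<Rightarrow> real" where
  "eprob U x y = measure cantor {\<pi> \<in> space cantor. runs U \<pi> x y \<and> runs U \<pi> y x}"

definition e_optimal :: "(bool list \<Rightarrow> bool list \<Rightarrow> bool list option) \<Rightarrow> bool" where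
  "e_optimal U \<longleftrightarrow> prefix_free2 U \<and> computable2 U \<and>
     (\<forall>W. prefix_free2 W \<and> computable2 W \<longrightarrow> (\<exists>c>0. \<forall>x y. eprob W x y \<le> c * eprob U x y))"

definition kp_optimal :: "(bool list \<Rightarrow> bool list \<Rightarrow> bool list option) \<Rightarrow> bool" where
  "kp_optimal V \<longleftrightarrow> prefix_free2 V \<and> computable2 V \<and>
     (\<forall>W. prefix_free2 W \<and> computable2 W \<longrightarrow>
        (\<exists>c::nat. \<forall>p x y. W p x = Some y \<longrightarrow> (\<exists>q. V q x = Some y \<and> length q \<le> length p + c)))"

definition KP :: "(bool list \<Rightarrow> bool list \<Rightarrow> bool list option) \<Rightarrow> bool list \<Rightarrow> bool list \<Rightarrow> nat" where
  "KP V y x = (LEAST n. \<exists>p. length p = n \<and> V p x = Some y)"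

end

theory Submission
  imports Defs "HOL-Library.Nat_Bijection"
begin

text \<open>Let \<open>P\<^sub>U(y|x)\<close> be the probability that \<open>U(\<pi>,x) = y\<close>.

  Trivially \<open>e\<^sub>U(x,y) \<le> min (P\<^sub>U(y|x)) (P\<^sub>U(x|y))\<close>, and the coding theorem
  \<open>KP(y|x) \<le> - log P\<^sub>U(y|x) + O(1)\<close> bounds the maximum of the two complexities by \<open>- log e + O(1)\<close>.
  For the coding theorem, each observed inequality \<open>P\<^sub>U(y|x) \<ge> 2^-k\<close> requests a program of length about
  \<open>k\<close>; the requests for a given \<open>x\<close> receive consecutive intervals, and a dyadic interval inside each of
  them is the program.

  Conversely, regard strings as vertices of a graph. When \<open>P\<^sub>V(y|x) \<ge> 2^-k\<close> and \<open>P\<^sub>V(x|y) \<ge> 2^-k\<close>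
  are observed, the edge between \<open>x\<close> and \<open>y\<close> requests a set of sequences \<open>\<pi>\<close> of measure \<open>2^-(k+4)\<close> on which
  a new machine maps \<open>x\<close> to \<open>y\<close> and \<open>y\<close> to \<open>x\<close>. The requests at one vertex have total measure at most
  \<open>1/4\<close>, so the two endpoints of an edge block at most half of all sequences and a greedy choice always succeeds.
  The chosen set need not be a single cylinder: being a finite union of cylinders is enough for its measure to count.\<close>

section \<open>Total recursive functions\<close>

text \<open>Unary functions suffice: an environment of several variables is packed into one number with
  \<^const>\<open>prod_encode\<close>, and entering the scope of a binder replaces the environment \<open>e\<close> by \<open>prod_encode (i, e)\<close>.\<close>

definition recursive :: "(nat \<Rightarrow> nat) \<Rightarrow> bool" where
  "recursive f \<longleftrightarrow> (\<exists>r. \<forall>z. eval r [z] (f z))"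

definition recursive2 :: "(nat \<Rightarrow> nat \<Rightarrow> nat) \<Rightarrow> bool" where
  "recursive2 f \<longleftrightarrow> (\<exists>r. \<forall>x y. eval r [x, y] (f x y))"

definition decidable :: "(nat \<Rightarrow> bool) \<Rightarrow> bool" where
  "decidable P \<longleftrightarrow> recursive (\<lambda>z. of_bool (P z))"

abbreviation pfst :: "nat \<Rightarrow> nat" where "pfst z \<equiv> fst (prod_decode z)"
abbreviation psnd :: "nat \<Rightarrow> nat" where "psnd z \<equiv> snd (prod_decode z)"

lemma eval_Cn1: "eval g xs y \<Longrightarrow> eval f [y] z \<Longrightarrow> eval (Cn f [g]) xs z"
  by (rule eval_Cn[where ys = "[y]"]) auto

lemma eval_Cn2: "eval g xs y \<Longrightarrow> eval g' xs y' \<Longrightarrow> eval f [y, y'] z \<Longrightarrow> eval (Cn f [g, g']) xs z"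
  by (rule eval_Cn[where ys = "[y, y']"]) auto

lemma eval_Id_nth: "i < length xs \<Longrightarrow> xs ! i = y \<Longrightarrow> eval (Id i) xs y"
  using eval_Id by blast

lemma eval_Pr_rec_nat:
  assumes "eval g xs y" and "\<And>k r. eval h (k # r # xs) (H k r)"
  shows "eval (Pr g h) (n # xs) (rec_nat y H n)"
proof (induction n)
  case 0
  then show ?case using assms(1) by (auto intro: eval_Pr0)
next
  case (Suc n)
  then show ?case using assms(2) by (auto intro: eval_PrS)
qed

lemma recursive_const: "recursive (\<lambda>z. c)"
  unfolding recursive_def
proof (induction c)
  case 0
  then show ?case by (auto intro: eval_Z)
next
  case (Suc c)
  then obtain r where "\<forall>z. eval r [z] c" by blast
  then have "eval (Cn S [r]) [z] (Suc c)" for z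
    by (auto intro!: eval_Cn1 eval_S)
  then show ?case by blast
qed

lemma recursive_id: "recursive (\<lambda>z. z)"
  unfolding recursive_def by (rule exI[of _ "Id 0"]) (auto intro: eval_Id_nth)

lemma recursive_comp:
  assumes "recursive g" "recursive f"
  shows "recursive (\<lambda>z. g (f z))"
proof -
  obtain a b where "\<And>z. eval a [z] (g z)" "\<And>z. eval b [z] (f z)"
    using assms unfolding recursive_def by blast
  then have "eval (Cn a [b]) [z] (g (f z))" for z by (auto intro: eval_Cn1)
  then show ?thesis unfolding recursive_def by blast
qed

lemma recursive2_comp:
  assumes "recursive2 g" "recursive f" "recursive f'"
  shows "recursive (\<lambda>z. g (f z) (f' z))"
proof -
  obtain a b b' where "\<And>x y. eval a [x, y] (g x y)" "\<And>z. eval b [z] (f z)" "\<And>z. eval b' [z] (f' z)"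
    using assms unfolding recursive_def recursive2_def by blast
  then have "eval (Cn a [b, b']) [z] (g (f z) (f' z))" for z by (intro eval_Cn2)
  then show ?thesis unfolding recursive_def by blast
qed

lemma recursive_Suc_fun: "recursive Suc"
  unfolding recursive_def by (rule exI[of _ S]) (auto intro: eval_S)

lemmas recursive_Suc = recursive_comp[OF recursive_Suc_fun]

lemma recursive2_plus: "recursive2 (+)"
proof -
  have "eval (Pr (Id 0) (Cn S [Id 1])) [x, y] (rec_nat y (\<lambda>_. Suc) x)" for x y
    by (rule eval_Pr_rec_nat) (auto intro!: eval_Cn1 eval_S eval_Id_nth)
  moreover have "rec_nat y (\<lambda>_. Suc) x = x + y" for x y by (induction x) auto
  ultimately show ?thesis unfolding recursive2_def by metis
qed

lemmas recursive_plus = recursive2_comp[OF recursive2_plus]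

lemma recursive2_mult: "recursive2 (*)"
proof -
  obtain a where a: "\<And>x y. eval a [x, y] (x + y)"
    using recursive2_plus unfolding recursive2_def by blast
  have "eval (Pr Z (Cn a [Id 1, Id 2])) [x, y] (rec_nat 0 (\<lambda>_ r. r + y) x)" for x y
    by (rule eval_Pr_rec_nat) (auto intro!: eval_Cn2 eval_Z eval_Id_nth a)
  moreover have "rec_nat 0 (\<lambda>_ r. r + y) x = x * y" for x y by (induction x) auto
  ultimately show ?thesis unfolding recursive2_def by metis
qed

lemmas recursive_mult = recursive2_comp[OF recursive2_mult]

lemma recursive_pred_fun: "recursive (\<lambda>z. z - 1)"
proof -
  have "eval (Pr Z (Id 0)) [x] (rec_nat 0 (\<lambda>k _. k) x)" for x
    by (rule eval_Pr_rec_nat) (auto intro!: eval_Z eval_Id_nth)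
  moreover have "rec_nat 0 (\<lambda>k _. k) x = x - 1" for x :: nat by (cases x) auto
  ultimately show ?thesis unfolding recursive_def by metis
qed

lemma recursive2_minus: "recursive2 (-)"
proof -
  obtain a where a: "\<And>x. eval a [x] (x - Suc 0)"
    using recursive_pred_fun unfolding recursive_def by auto
  have "eval (Pr (Id 0) (Cn a [Id 1])) [y, x] (rec_nat x (\<lambda>_ r. r - 1) y)" for x y
    by (rule eval_Pr_rec_nat) (auto intro!: eval_Cn1 eval_Id_nth a)
  moreover have "rec_nat x (\<lambda>_ r. r - 1) y = x - y" for x y :: nat by (induction y) auto
  ultimately have "eval (Pr (Id 0) (Cn a [Id 1])) [y, x] (x - y)" for x y by metis
  \<comment> \<open>\<open>Pr\<close> recurses on its first argument, which must be the subtrahend;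
    the outer composition restores the order of the arguments.\<close>
  then have "eval (Cn (Pr (Id 0) (Cn a [Id 1])) [Id 1, Id 0]) [x, y] (x - y)" for x y
    by (auto intro!: eval_Cn2 eval_Id_nth)
  then show ?thesis unfolding recursive2_def by blast
qed

lemmas recursive_minus = recursive2_comp[OF recursive2_minus]

section \<open>The Cantor pairing and its inverse\<close>

lemma recursive_triangle_fun: "recursive triangle"
proof -
  obtain a where a: "\<And>x y. eval a [x, y] (x + y)"
    using recursive2_plus unfolding recursive2_def by blast
  have "eval (Pr Z (Cn S [Cn a [Id 0, Id 1]])) [x] (rec_nat 0 (\<lambda>k r. Suc (k + r)) x)" for x
    by (rule eval_Pr_rec_nat) (auto intro!: eval_Cn2 eval_Cn1 eval_S eval_Z eval_Id_nth a)
  moreover have "rec_nat 0 (\<lambda>k r. Suc (k + r)) x = triangle x" for x by (induction x) auto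
  ultimately show ?thesis unfolding recursive_def by metis
qed

lemmas recursive_triangle = recursive_comp[OF recursive_triangle_fun]

lemma recursive2_pair: "recursive2 (\<lambda>x y. prod_encode (x, y))"
proof -
  obtain a where a: "\<And>x y. eval a [x, y] (x + y)"
    using recursive2_plus unfolding recursive2_def by blast
  obtain b where b: "\<And>x. eval b [x] (triangle x)"
    using recursive_triangle_fun unfolding recursive_def by blast
  have "eval (Cn a [Cn b [a], Id 0]) [x, y] (prod_encode (x, y))" for x y
    by (auto intro!: eval_Cn2 eval_Cn1 eval_Id_nth a b simp: prod_encode_def)
  then show ?thesis unfolding recursive2_def by blast
qed

lemmas recursive_pair = recursive2_comp[OF recursive2_pair]

text \<open>The number of the diagonal of the Cantor pairing on which \<open>z\<close> lies, in a form that is visibly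
  primitive recursive.\<close>

primrec diagonal :: "nat \<Rightarrow> nat" where
  "diagonal 0 = 0"
| "diagonal (Suc z) = diagonal z + (1 - (triangle (Suc (diagonal z)) - Suc z))"

text \<open>With \<open>d = diagonal z\<close>, the invariant
  \<open>triangle d \<le> z \<le> triangle d + d\<close> holds by induction on \<open>z\<close>; for
  \<open>z = triangle d + m\<close> with \<open>m \<le> d\<close>, decoding gives
  \<open>(m, d - m)\<close>.\<close>

lemma prod_decode_diagonal:
  "prod_decode z = (z - triangle (diagonal z), diagonal z - (z - triangle (diagonal z)))"
proof -
  have *: "triangle (diagonal z) \<le> z \<and> z - triangle (diagonal z) \<le> diagonal z"
  proof (induction z)
    case (Suc z)
    then show ?case
      by (cases "triangle (Suc (diagonal z)) \<le> Suc z") (auto simp: Suc_diff_le not_le)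
  qed simp
  then show ?thesis
    using prod_decode_triangle_add[of "diagonal z" "z - triangle (diagonal z)"]
    by (subst (asm) prod_decode_aux.simps) auto
qed

lemma recursive_diagonal: "recursive diagonal"
proof -
  have r: "recursive (\<lambda>d. triangle (Suc d))"
    by (intro recursive_triangle recursive_Suc recursive_id)
  obtain t where t: "\<And>x. eval t [x] (triangle (Suc x))"
    using r unfolding recursive_def by blast
  obtain m where m: "\<And>x y. eval m [x, y] (x - y)"
    using recursive2_minus unfolding recursive2_def by blast
  obtain a where a: "\<And>x y. eval a [x, y] (x + y)"
    using recursive2_plus unfolding recursive2_def by blast
  define h where "h = Cn a [Id 1, Cn m [Cn S [Z], Cn m [Cn t [Id 1], Cn S [Id 0]]]]"
  have "eval h [k, d] (d + (Suc 0 - (triangle (Suc d) - Suc k)))" for k d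
    unfolding h_def
    by (rule eval_Cn2 eval_Cn1 eval_S eval_Z a m t | (rule eval_Id_nth; simp))+
  then have "eval (Pr Z h) [x] (rec_nat 0 (\<lambda>k d. d + (Suc 0 - (triangle (Suc d) - Suc k))) x)" for x
    by (intro eval_Pr_rec_nat) (auto intro: eval_Z)
  moreover have "rec_nat 0 (\<lambda>k d. d + (Suc 0 - (triangle (Suc d) - Suc k))) x = diagonal x" for x
    by (induction x) auto
  ultimately show ?thesis unfolding recursive_def by metis
qed

lemma recursive_pfst_fun: "recursive pfst"
proof -
  have "recursive (\<lambda>z. z - triangle (diagonal z))"
    by (intro recursive_minus recursive_id recursive_triangle recursive_diagonal)
  then show ?thesis by (simp add: prod_decode_diagonal)
qed

lemma recursive_psnd_fun: "recursive psnd"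
proof -
  have "recursive (\<lambda>z. diagonal z - (z - triangle (diagonal z)))"
    by (intro recursive_minus recursive_id recursive_triangle recursive_diagonal)
  then show ?thesis by (simp add: prod_decode_diagonal)
qed

lemmas recursive_pfst = recursive_comp[OF recursive_pfst_fun]
lemmas recursive_psnd = recursive_comp[OF recursive_psnd_fun]

text \<open>Counter, accumulator and environment are packed into one argument, so the third premise
  is again a statement about a unary function and the closure rules apply to the body of the
  recursion.\<close>

lemma recursive_rec_nat:
  assumes "recursive g" "recursive n"
    and "recursive (\<lambda>z. H (pfst z) (pfst (psnd z)) (psnd (psnd z)))"
  shows "recursive (\<lambda>e. rec_nat (g e) (\<lambda>k r. H k r e) (n e))"
proof -
  obtain a where a: "\<And>z. eval a [z] (g z)" using assms(1) unfolding recursive_def by blast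
  obtain b where b: "\<And>z. eval b [z] (n z)" using assms(2) unfolding recursive_def by blast
  obtain h where "\<And>z. eval h [z] (H (pfst z) (pfst (psnd z)) (psnd (psnd z)))"
    using assms(3) unfolding recursive_def by blast
  from this[of "prod_encode (k, prod_encode (r, e))" for k r e]
  have h: "eval h [prod_encode (k, prod_encode (r, e))] (H k r e)" for k r e by simp
  obtain p where p: "\<And>x y. eval p [x, y] (prod_encode (x, y))"
    using recursive2_pair unfolding recursive2_def by blast
  have "eval (Pr a (Cn h [Cn p [Id 0, Cn p [Id 1, Id 2]]])) [m, e] (rec_nat (g e) (\<lambda>k r. H k r e) m)" for m e
    by (rule eval_Pr_rec_nat, rule a)
      (rule eval_Cn1 eval_Cn2 p h | (rule eval_Id_nth; simp))+
  then have "eval (Cn (Pr a (Cn h [Cn p [Id 0, Cn p [Id 1, Id 2]]])) [b, Id 0]) [e]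
      (rec_nat (g e) (\<lambda>k r. H k r e) (n e))" for e
    by (auto intro!: eval_Cn2 b eval_Id_nth)
  then show ?thesis unfolding recursive_def by blast
qed

lemma recursive_sum:
  assumes "recursive n" "recursive (\<lambda>z. F (pfst z) (psnd z))"
  shows "recursive (\<lambda>e. \<Sum>i<n e. F i e)"
proof -
  \<comment> \<open>The recursion packs \<open>(k, (r, e))\<close> while \<open>F\<close> reads
    \<open>(k, e)\<close>: the accumulator is removed by repacking.\<close>
  have "recursive (\<lambda>z. F (pfst (prod_encode (pfst z, psnd (psnd z)))) (psnd (prod_encode (pfst z, psnd (psnd z)))))"
    by (rule recursive_comp[OF assms(2)]) (intro recursive_pair recursive_pfst recursive_psnd recursive_id)
  then have "recursive (\<lambda>e. rec_nat 0 (\<lambda>k r. r + F k e) (n e))"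
    by (intro recursive_rec_nat recursive_const assms(1) recursive_plus recursive_pfst recursive_psnd recursive_id) simp
  moreover have "rec_nat 0 (\<lambda>k r. r + F k e) m = (\<Sum>i<m. F i e)" for m e by (induction m) auto
  ultimately show ?thesis by simp
qed

lemma recursive_power:
  assumes "recursive f" "recursive n"
  shows "recursive (\<lambda>z. f z ^ n z)"
proof -
  have "recursive (\<lambda>z. rec_nat 1 (\<lambda>k r. r * f z) (n z))"
    by (intro recursive_rec_nat recursive_const assms(2) recursive_mult recursive_pfst recursive_psnd
        recursive_id recursive_comp[OF assms(1)])
  moreover have "rec_nat 1 (\<lambda>k r. r * x) m = x ^ m" for x m :: nat by (induction m) auto
  ultimately show ?thesis by simp
qed

section \<open>Decidable predicates, bounded quantifiers and division\<close>

lemma decidable_le: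
  assumes "recursive f" "recursive g"
  shows "decidable (\<lambda>z. f z \<le> g z)"
proof -
  have "recursive (\<lambda>z. 1 - (f z - g z))" by (intro recursive_minus recursive_const assms)
  moreover have "1 - (a - b) = of_bool (a \<le> b)" for a b :: nat by simp
  ultimately show ?thesis unfolding decidable_def by simp
qed

lemma decidable_not:
  assumes "decidable P"
  shows "decidable (\<lambda>z. \<not> P z)"
proof -
  have "recursive (\<lambda>z. 1 - of_bool (P z))"
    by (intro recursive_minus recursive_const assms[unfolded decidable_def])
  moreover have "1 - of_bool b = (of_bool (\<not> b) :: nat)" for b by simp
  ultimately show ?thesis unfolding decidable_def by simp
qed

lemma decidable_conj:
  assumes "decidable P" "decidable Q"
  shows "decidable (\<lambda>z. P z \<and> Q z)"
  using recursive_mult[OF assms[unfolded decidable_def]] unfolding decidable_def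
  by (simp add: of_bool_conj)

lemma decidable_disj:
  assumes "decidable P" "decidable Q"
  shows "decidable (\<lambda>z. P z \<or> Q z)"
  using decidable_not[OF decidable_conj[OF decidable_not[OF assms(1)] decidable_not[OF assms(2)]]]
  by simp

lemma decidable_less:
  assumes "recursive f" "recursive g"
  shows "decidable (\<lambda>z. f z < g z)"
  using decidable_not[OF decidable_le[OF assms(2,1)]] by (simp add: not_le)

lemma decidable_eq:
  assumes "recursive f" "recursive g"
  shows "decidable (\<lambda>z. f z = g z)"
  using decidable_conj[OF decidable_le[OF assms] decidable_le[OF assms(2,1)]] by (simp add: eq_iff)

lemma recursive_of_bool: "decidable P \<Longrightarrow> recursive (\<lambda>z. of_bool (P z))"
  by (simp add: decidable_def)

lemma recursive_if:
  assumes "decidable P" "recursive f" "recursive g"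
  shows "recursive (\<lambda>z. if P z then f z else g z)"
proof -
  have "recursive (\<lambda>z. of_bool (P z) * f z + of_bool (\<not> P z) * g z)"
    by (intro recursive_plus recursive_mult recursive_of_bool decidable_not assms)
  moreover have "of_bool b * x + of_bool (\<not> b) * y = (if b then x else y)" for b and x y :: nat by simp
  ultimately show ?thesis by simp
qed

lemma decidable_ex_less:
  assumes "recursive n" "decidable (\<lambda>z. P (pfst z) (psnd z))"
  shows "decidable (\<lambda>e. \<exists>i<n e. P i e)"
proof -
  have "decidable (\<lambda>e. 0 < (\<Sum>i<n e. of_bool (P i e) :: nat))"
    by (intro decidable_less recursive_const recursive_sum recursive_of_bool assms)
  moreover have "(0 < (\<Sum>i<m. of_bool (Q i) :: nat)) = (\<exists>i<m. Q i)" for m :: nat and Q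
    by (induction m) (auto simp: less_Suc_eq)
  ultimately show ?thesis by simp
qed

lemma decidable_ex_le:
  assumes "recursive n" "decidable (\<lambda>z. P (pfst z) (psnd z))"
  shows "decidable (\<lambda>e. \<exists>i\<le>n e. P i e)"
  using decidable_ex_less[of "\<lambda>z. Suc (n z)", OF recursive_Suc[OF assms(1)] assms(2)]
  by (simp add: less_Suc_eq_le)

lemma decidable_all_less:
  assumes "recursive n" "decidable (\<lambda>z. P (pfst z) (psnd z))"
  shows "decidable (\<lambda>e. \<forall>i<n e. P i e)"
  using decidable_not[OF decidable_ex_less[OF assms(1) decidable_not[OF assms(2)]]] by simp

lemma recursive_div:
  assumes "recursive f" "recursive g"
  shows "recursive (\<lambda>z. f z div g z)"
proof -
  \<comment> \<open>The quotient counts the positive multiples of \<open>b\<close> up to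
    \<open>a\<close>; the guard \<open>0 < b\<close> reproduces the convention
    \<open>a div 0 = 0\<close>.\<close>
  have eq: "a div b = (\<Sum>i<a. of_bool (0 < b \<and> Suc i * b \<le> a))" for a b :: nat
  proof (cases "b = 0")
    case False
    have "(\<Sum>i<a. of_bool (0 < b \<and> Suc i * b \<le> a)) = card ({..<a} \<inter> {i. 0 < b \<and> Suc i * b \<le> a})"
      by (simp add: sum.If_cases of_bool_def)
    also have "{..<a} \<inter> {i. 0 < b \<and> Suc i * b \<le> a} = {..<a div b}"
    proof -
      have "Suc i * b \<le> a \<longleftrightarrow> i < a div b" for i
        using False by (metis Suc_le_eq less_eq_div_iff_mult_less_eq neq0_conv)
      moreover have "i < a div b \<Longrightarrow> i < a" for i
        by (meson div_le_dividend less_le_trans)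
      ultimately show ?thesis using False by auto
    qed
    finally show ?thesis by simp
  qed simp
  have "recursive (\<lambda>z. \<Sum>i<f z. of_bool (0 < g z \<and> Suc i * g z \<le> f z))"
    by (intro recursive_sum recursive_of_bool decidable_conj decidable_less decidable_le recursive_mult
        recursive_Suc recursive_const recursive_pfst recursive_id assms
        recursive_comp[OF assms(1)] recursive_comp[OF assms(2)] recursive_psnd)
  then show ?thesis by (simp add: eq)
qed

lemma recursive_mod:
  assumes "recursive f" "recursive g"
  shows "recursive (\<lambda>z. f z mod g z)"
  using recursive_minus[OF assms(1) recursive_mult[OF recursive_div[OF assms] assms(2)]]
  by (simp add: minus_div_mult_eq_mod)

text \<open>These rules follow the syntax of a term, so recursiveness of anything written with
  arithmetic, bounded sums, bounded quantifiers and \<open>rec_nat\<close> is found by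
  \<open>intro\<close>. The later constructions are phrased in these terms for that reason.\<close>

lemmas recursive_intros =
  recursive_id recursive_const recursive_Suc recursive_plus recursive_mult recursive_minus recursive_power
  recursive_div recursive_mod recursive_pair recursive_pfst recursive_psnd recursive_of_bool recursive_if
  recursive_sum recursive_rec_nat decidable_le decidable_less decidable_eq decidable_not decidable_conj
  decidable_disj decidable_ex_less decidable_ex_le decidable_all_less

section \<open>Clocked evaluation\<close>

text \<open>Evaluation with clock \<open>s\<close>: the value \<open>0\<close> means that no result has been found, \<open>Suc y\<close> that the
  result is \<open>y\<close>. The clock only limits the range of unbounded searches; the sum in the last
  equation has at most one nonzero term.\<close>

fun run :: "recf \<Rightarrow> nat \<Rightarrow> nat list \<Rightarrow> nat" where
  "run Z s xs = 1"
| "run S s xs = (case xs of [] \<Rightarrow> 0 | x # _ \<Rightarrow> Suc (Suc x))"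
| "run (Id i) s xs = (if i < length xs then Suc (xs ! i) else 0)"
| "run (Cn f gs) s xs =
    (if \<forall>g \<in> set gs. 0 < run g s xs then run f s (map (\<lambda>g. run g s xs - 1) gs) else 0)"
| "run (Pr g h) s xs = (case xs of [] \<Rightarrow> 0 | k # ys \<Rightarrow>
    rec_nat (run g s ys) (\<lambda>j r. if r = 0 then 0 else run h s (j # (r - 1) # ys)) k)"
| "run (Mn f) s xs =
    (\<Sum>k<s. if run f s (k # xs) = 1 \<and> (\<forall>i<k. 1 < run f s (i # xs)) then Suc k else 0)"

text \<open>Two different indices cannot both contribute: the smaller one has value 1, while the
  larger one requires all values before it to exceed 1. In the shifted encoding, 1 stands for the
  result 0 and larger values for positive results.\<close>

lemma sum_first_hit:
  fixes r :: "nat \<Rightarrow> nat" and s :: nat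
  shows "(\<Sum>k<s. if r k = 1 \<and> (\<forall>i<k. 1 < r i) then Suc k else 0) = Suc y \<longleftrightarrow>
    y < s \<and> r y = 1 \<and> (\<forall>i<y. 1 < r i)"
proof -
  let ?P = "\<lambda>k. r k = 1 \<and> (\<forall>i<k. 1 < r i)"
  have uniq: "j = k" if "?P j" "?P k" for j k
    using that by (metis less_irrefl linorder_neqE_nat)
  show ?thesis
  proof (cases "\<exists>k<s. ?P k")
    case True
    then obtain k where k: "k < s" "?P k" by blast
    have P: "?P j \<longleftrightarrow> j = k" for j using uniq[OF _ k(2)] k(2) by blast
    show ?thesis unfolding P using k(1) by auto
  next
    case False
    then have "(\<Sum>j<s. if ?P j then Suc j else 0) = (\<Sum>j<s. 0)"
      by (intro sum.cong) auto
    with False show ?thesis by auto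
  qed
qed

text \<open>Only the \<open>Mn\<close> clause reads the clock. There a longer search cannot change a
  value already found, because by \<open>sum_first_hit\<close> the hit is unique.\<close>

lemma run_mono: "run f s xs = Suc y \<Longrightarrow> s \<le> s' \<Longrightarrow> run f s' xs = Suc y"
proof (induction f arbitrary: xs y)
  case (Cn f gs)
  from Cn.prems have pos: "\<forall>g \<in> set gs. 0 < run g s xs"
    and f: "run f s (map (\<lambda>g. run g s xs - 1) gs) = Suc y"
    by (auto split: if_splits)
  have "run g s' xs = run g s xs" if "g \<in> set gs" for g
    using Cn.IH(2)[OF that, of xs "run g s xs - 1"] pos that Cn.prems(2) by auto
  with pos f Cn.IH(1)[OF f Cn.prems(2)] show ?case by (simp cong: map_cong)
next
  case (Pr g h)
  then obtain k ys where xs: "xs = k # ys" by (auto split: list.splits)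
  have "rec_nat (run g s ys) (\<lambda>j r. if r = 0 then 0 else run h s (j # (r - 1) # ys)) k = Suc y \<Longrightarrow>
    rec_nat (run g s' ys) (\<lambda>j r. if r = 0 then 0 else run h s' (j # (r - 1) # ys)) k = Suc y" for y
  proof (induction k arbitrary: y)
    case 0
    then show ?case using Pr.IH(1) Pr.prems(2) by simp
  next
    case (Suc k)
    let ?r = "rec_nat (run g s ys) (\<lambda>j r. if r = 0 then 0 else run h s (j # (r - 1) # ys)) k"
    from Suc.prems obtain r where r: "?r = Suc r" by (cases ?r) auto
    with Suc.prems have "run h s (k # r # ys) = Suc y" by simp
    then show ?case using Suc.IH[OF r] Pr.IH(2) Pr.prems(2) by simp
  qed
  with Pr.prems(1) show ?case by (simp add: xs)
next
  case (Mn f)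
  from Mn.prems(1) have y: "y < s" "run f s (y # xs) = 1" "\<forall>i<y. 1 < run f s (i # xs)"
    unfolding run.simps sum_first_hit by auto
  have "run f s' (y # xs) = 1" using Mn.IH[of "y # xs" 0] y Mn.prems(2) by simp
  moreover have "1 < run f s' (i # xs)" if "i < y" for i
    using Mn.IH[of "i # xs" "run f s (i # xs) - 1"] y(3) that Mn.prems(2) by fastforce
  ultimately show ?case using y Mn.prems(2) unfolding run.simps sum_first_hit by auto
qed (auto split: list.splits)

lemma run_sound: "run f s xs = Suc y \<Longrightarrow> eval f xs y"
proof (induction f arbitrary: xs y)
  case Z
  then show ?case by (auto intro: eval_Z)
next
  case S
  then show ?case by (auto intro: eval_S split: list.splits)
next
  case (Id i)
  then show ?case by (auto intro: eval_Id split: if_splits)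
next
  case (Cn f gs)
  from Cn.prems have pos: "\<forall>g \<in> set gs. 0 < run g s xs"
    and f: "run f s (map (\<lambda>g. run g s xs - 1) gs) = Suc y"
    by (auto split: if_splits)
  have "list_all2 (\<lambda>g y. eval g xs y) gs (map (\<lambda>g. run g s xs - 1) gs)"
    using Cn.IH(2) pos by (auto simp: list_all2_map2 intro!: list.rel_refl_strong)
  then show ?case using Cn.IH(1)[OF f] by (rule eval_Cn)
next
  case (Pr g h)
  then obtain k ys where xs: "xs = k # ys" by (auto split: list.splits)
  have "rec_nat (run g s ys) (\<lambda>j r. if r = 0 then 0 else run h s (j # (r - 1) # ys)) k = Suc y \<Longrightarrow>
    eval (Pr g h) (k # ys) y" for y
  proof (induction k arbitrary: y)
    case 0
    then show ?case using Pr.IH(1) by (auto intro: eval_Pr0)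
  next
    case (Suc k)
    let ?r = "rec_nat (run g s ys) (\<lambda>j r. if r = 0 then 0 else run h s (j # (r - 1) # ys)) k"
    from Suc.prems obtain r where r: "?r = Suc r" by (cases ?r) auto
    with Suc.prems have "run h s (k # r # ys) = Suc y" by simp
    then show ?case using Suc.IH[OF r] Pr.IH(2) by (blast intro: eval_PrS)
  qed
  with Pr.prems(1) show ?case by (simp add: xs)
next
  case (Mn f)
  from Mn.prems have y: "run f s (y # xs) = 1" "\<forall>i<y. 1 < run f s (i # xs)"
    unfolding run.simps sum_first_hit by auto
  have "\<exists>v. eval f (i # xs) v \<and> v > 0" if "i < y" for i
    using Mn.IH[of "i # xs" "run f s (i # xs) - 1"] y(2) that by fastforce
  then show ?case using Mn.IH[of "y # xs" 0] y(1) by (auto intro: eval_Mn)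
qed

text \<open>Gives finitely many terminating evaluations a common clock.\<close>

lemma eventually_all_of_mono:
  fixes P :: "'a \<Rightarrow> nat \<Rightarrow> bool"
  assumes "finite A" "\<And>a. a \<in> A \<Longrightarrow> \<exists>s. P a s" "\<And>a s s'. P a s \<Longrightarrow> s \<le> s' \<Longrightarrow> P a s'"
  shows "\<exists>s. \<forall>a\<in>A. \<forall>s'\<ge>s. P a s'"
  using assms(1,2)
proof (induction A)
  case (insert a A)
  obtain s where s: "\<forall>a\<in>A. \<forall>s'\<ge>s. P a s'" using insert.IH insert.prems by auto
  obtain s' where "P a s'" using insert.prems by auto
  then show ?case using s assms(3) by (intro exI[of _ "max s s'"]) auto
qed simp

lemma run_complete: "eval f xs y \<Longrightarrow> \<exists>s. run f s xs = Suc y"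
proof (induction rule: eval.induct)
  case (eval_Cn xs gs ys f z)
  have len: "length gs = length ys" using eval_Cn.IH(1) by (auto dest: list_all2_lengthD)
  have "\<exists>s. run (gs ! i) s xs = Suc (ys ! i)" if "i \<in> {..<length gs}" for i
    using eval_Cn.IH(1) that by (auto simp: list_all2_conv_all_nth)
  then have "\<exists>s. \<forall>i\<in>{..<length gs}. \<forall>s'\<ge>s. run (gs ! i) s' xs = Suc (ys ! i)"
    by (intro eventually_all_of_mono finite_lessThan) (blast, rule run_mono)
  then obtain s where s: "\<And>i s'. i < length gs \<Longrightarrow> s \<le> s' \<Longrightarrow> run (gs ! i) s' xs = Suc (ys ! i)"
    by auto
  obtain s1 where s1: "run f s1 ys = Suc z" using eval_Cn.IH(2) by blast
  let ?s = "max s s1"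
  have "map (\<lambda>g. run g ?s xs - 1) gs = ys" by (rule nth_equalityI) (auto simp: len s)
  moreover have "\<forall>g \<in> set gs. 0 < run g ?s xs" using s by (auto simp: in_set_conv_nth)
  moreover have "run f ?s ys = Suc z" by (rule run_mono[OF s1]) simp
  ultimately show ?case by (intro exI[of _ ?s]) simp
next
  case (eval_PrS g h k xs y z)
  then obtain s s' where s: "run (Pr g h) s (k # xs) = Suc y" "run h s' (k # y # xs) = Suc z" by blast
  have "run (Pr g h) (max s s') (k # xs) = Suc y" "run h (max s s') (k # y # xs) = Suc z"
    by (rule run_mono[OF s(1)] run_mono[OF s(2)], simp)+
  then show ?case by (intro exI[of _ "max s s'"]) simp
next
  case (eval_Mn f k xs)
  have "\<exists>s. 1 < run f s (i # xs)" if "i \<in> {..<k}" for i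
    using eval_Mn.IH(2) that by (metis One_nat_def Suc_less_eq lessThan_iff)
  moreover have "1 < run f s' (i # xs)" if "1 < run f s (i # xs)" "s \<le> s'" for i s s'
    using run_mono[of f s "i # xs" "run f s (i # xs) - 1" s'] that by simp
  ultimately have "\<exists>s. \<forall>i\<in>{..<k}. \<forall>s'\<ge>s. 1 < run f s' (i # xs)"
    by (intro eventually_all_of_mono finite_lessThan) blast+
  then obtain s where s: "\<And>i s'. i < k \<Longrightarrow> s \<le> s' \<Longrightarrow> 1 < run f s' (i # xs)" by auto
  obtain s1 where s1: "run f s1 (k # xs) = Suc 0" using eval_Mn.IH(1) by blast
  \<comment> \<open>\<open>Suc\<close> because the search in \<open>run\<close> ranges over values
    strictly below the clock.\<close>
  let ?s = "Suc (max k (max s s1))"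
  have "run f ?s (k # xs) = 1" using run_mono[OF s1, of ?s] by simp
  then have "run (Mn f) ?s xs = Suc k" unfolding run.simps sum_first_hit using s by simp
  then show ?case by blast
qed auto

text \<open>Both derivations are reproduced at a common clock, where the function \<open>run\<close>
  has one value.\<close>

lemma eval_deterministic:
  assumes "eval f xs y" "eval f xs y'"
  shows "y = y'"
proof -
  obtain s s' where "run f s xs = Suc y" "run f s' xs = Suc y'"
    using run_complete assms by meson
  then have "run f (max s s') xs = Suc y" "run f (max s s') xs = Suc y'"
    using run_mono max.cobounded1 max.cobounded2 by blast+
  then show ?thesis by simp
qed

section \<open>The clocked evaluator as a recursive function of packed arguments\<close>

primrec tuple_encode :: "nat list \<Rightarrow> nat" where
  "tuple_encode [] = 0"
| "tuple_encode (x # xs) = prod_encode (x, tuple_encode xs)"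

lemma recursive_nth_tuple:
  "\<exists>t. recursive t \<and> (\<forall>xs. i < length xs \<longrightarrow> t (tuple_encode xs) = xs ! i)"
proof (induction i)
  case 0
  have "\<forall>xs. 0 < length xs \<longrightarrow> pfst (tuple_encode xs) = xs ! 0"
    by (auto simp: neq_Nil_conv)
  then show ?case using recursive_pfst_fun by blast
next
  case (Suc i)
  then obtain t where t: "recursive t" "\<And>xs. i < length xs \<Longrightarrow> t (tuple_encode xs) = xs ! i" by blast
  have "t (psnd (tuple_encode xs)) = xs ! Suc i" if "Suc i < length xs" for xs
    using that t(2) by (cases xs) auto
  moreover have "recursive (\<lambda>z. t (psnd z))" by (rule recursive_comp[OF t(1) recursive_psnd_fun])
  ultimately show ?case by blast
qed

text \<open>The evaluator is built separately for each program \<open>f\<close> and arity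
  \<open>n\<close>, by induction on \<open>f\<close>, in place of a universal machine reading a code
  of \<open>f\<close>.\<close>

lemma recursive_run:
  "\<exists>t. recursive t \<and> (\<forall>s xs. length xs = n \<longrightarrow> t (prod_encode (s, tuple_encode xs)) = run f s xs)"
proof (induction f arbitrary: n)
  case Z
  show ?case by (rule exI[of _ "\<lambda>_. 1"]) (auto intro: recursive_const)
next
  case S
  show ?case
  proof (cases n)
    case 0
    then show ?thesis by (intro exI[of _ "\<lambda>_. 0"]) (auto intro: recursive_const)
  next
    case (Suc m)
    then show ?thesis
      by (intro exI[of _ "\<lambda>z. Suc (Suc (pfst (psnd z)))"])
        (auto intro!: recursive_intros simp: length_Suc_conv)
  qed
next
  case (Id i)
  show ?case
  proof (cases "i < n")
    case True
    obtain t where "recursive t" "\<And>xs. i < length xs \<Longrightarrow> t (tuple_encode xs) = xs ! i"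
      using recursive_nth_tuple by blast
    then show ?thesis using True
      by (intro exI[of _ "\<lambda>z. Suc (t (psnd z))"]) (auto intro!: recursive_Suc recursive_comp[of t] recursive_psnd_fun)
  next
    case False
    then show ?thesis by (intro exI[of _ "\<lambda>_. 0"]) (auto intro: recursive_const)
  qed
next
  case (Cn f gs)
  \<comment> \<open>An inner induction over \<open>gs\<close> yields two objects: \<open>a\<close>
    packs the results and \<open>b\<close> records whether all of them are defined.\<close>
  have "\<exists>a b. recursive a \<and> decidable b \<and> (\<forall>s xs. length xs = n \<longrightarrow>
      a (prod_encode (s, tuple_encode xs)) = tuple_encode (map (\<lambda>g. run g s xs - 1) gs) \<and>
      b (prod_encode (s, tuple_encode xs)) = (\<forall>g \<in> set gs. 0 < run g s xs))"
    using Cn.IH(2)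
  proof (induction gs)
    case Nil
    have "decidable (\<lambda>z. z = z)" by (intro recursive_intros)
    then show ?case
      by (intro exI[of _ "\<lambda>_. 0"] exI[of _ "\<lambda>_. True"]) (auto intro: recursive_const)
  next
    case (Cons g gs)
    then obtain a b where ab: "recursive a" "decidable b" "\<And>s xs. length xs = n \<Longrightarrow>
      a (prod_encode (s, tuple_encode xs)) = tuple_encode (map (\<lambda>g. run g s xs - 1) gs) \<and>
      b (prod_encode (s, tuple_encode xs)) = (\<forall>g \<in> set gs. 0 < run g s xs)"
      by (auto simp del: One_nat_def)
    obtain t where t: "recursive t" "\<And>s xs. length xs = n \<Longrightarrow> t (prod_encode (s, tuple_encode xs)) = run g s xs"
      using Cons.prems[of g n] by (metis list.set_intros(1))
    show ?case
      by (intro exI[of _ "\<lambda>z. prod_encode (t z - 1, a z)"] exI[of _ "\<lambda>z. 0 < t z \<and> b z"])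
        (auto intro!: recursive_intros ab(1,2) t(1) simp: ab(3) t(2))
  qed
  then obtain a b where ab: "recursive a" "decidable b" "\<And>s xs. length xs = n \<Longrightarrow>
      a (prod_encode (s, tuple_encode xs)) = tuple_encode (map (\<lambda>g. run g s xs - 1) gs) \<and>
      b (prod_encode (s, tuple_encode xs)) = (\<forall>g \<in> set gs. 0 < run g s xs)"
    by blast
  obtain t where t: "recursive t"
    "\<And>s xs. length xs = length gs \<Longrightarrow> t (prod_encode (s, tuple_encode xs)) = run f s xs"
    using Cn.IH(1) by blast
  show ?case
    by (intro exI[of _ "\<lambda>z. if b z then t (prod_encode (pfst z, a z)) else 0"])
      (auto intro!: recursive_if recursive_const ab(1,2) recursive_comp[OF t(1)]
        recursive_pair recursive_pfst_fun simp: ab(3) t(2))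
next
  case (Pr g h)
  show ?case
  proof (cases n)
    case 0
    then show ?thesis by (intro exI[of _ "\<lambda>_. 0"]) (auto intro: recursive_const)
  next
    case (Suc m)
    obtain a where a: "recursive a" "\<And>s xs. length xs = m \<Longrightarrow> a (prod_encode (s, tuple_encode xs)) = run g s xs"
      using Pr.IH(1) by blast
    obtain b where b: "recursive b"
      "\<And>s xs. length xs = Suc (Suc m) \<Longrightarrow> b (prod_encode (s, tuple_encode xs)) = run h s xs"
      using Pr.IH(2) by blast
    let ?t = "\<lambda>z. rec_nat (a (prod_encode (pfst z, psnd (psnd z))))
       (\<lambda>j r. if r = 0 then 0 else
          b (prod_encode (pfst z, prod_encode (j, prod_encode (r - 1, psnd (psnd z))))))
       (pfst (psnd z))"
    have "recursive ?t"
      by (intro recursive_intros recursive_comp[OF a(1)] recursive_comp[OF b(1)])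
    moreover have "?t (prod_encode (s, tuple_encode xs)) = run (Pr g h) s xs" if xs: "length xs = n" for s xs
    proof -
      obtain k ys where ys: "xs = k # ys" "length ys = m" using xs Suc by (auto simp: length_Suc_conv)
      have "b (prod_encode (s, prod_encode (j, prod_encode (r, tuple_encode ys)))) = run h s (j # r # ys)" for j r
        using b(2)[of "j # r # ys" s] ys by simp
      then show ?thesis by (simp add: ys(1) a(2) ys(2) cong: if_cong)
    qed
    ultimately show ?thesis by blast
  qed
next
  case (Mn f)
  obtain a where a: "recursive a"
    "\<And>s xs. length xs = Suc n \<Longrightarrow> a (prod_encode (s, tuple_encode xs)) = run f s xs"
    using Mn.IH by blast
  let ?r = "\<lambda>z k. a (prod_encode (pfst z, prod_encode (k, psnd z)))"
  let ?t = "\<lambda>z. \<Sum>k<pfst z. if ?r z k = 1 \<and> (\<forall>i<k. 1 < ?r z i) then Suc k else 0"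
  have "recursive ?t" by (intro recursive_intros recursive_comp[OF a(1)])
  moreover have "?t (prod_encode (s, tuple_encode xs)) = run (Mn f) s xs" if xs: "length xs = n" for s xs
  proof -
    have "a (prod_encode (s, prod_encode (k, tuple_encode xs))) = run f s (k # xs)" for k
      using a(2)[of "k # xs" s] xs by simp
    then show ?thesis by simp
  qed
  ultimately show ?case by blast
qed

section \<open>Computable string functions\<close>

definition recursive3 :: "(nat \<Rightarrow> nat \<Rightarrow> nat \<Rightarrow> nat) \<Rightarrow> bool" where
  "recursive3 f \<longleftrightarrow> recursive (\<lambda>z. f (pfst z) (pfst (psnd z)) (psnd (psnd z)))"

lemma recursive3_comp:
  assumes "recursive3 g" "recursive a" "recursive b" "recursive c"
  shows "recursive (\<lambda>z. g (a z) (b z) (c z))"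
  using recursive_comp[OF assms(1)[unfolded recursive3_def]
      recursive_pair[OF assms(2) recursive_pair[OF assms(3,4)]]] by simp

lemma enc_inject [simp]: "enc p = enc q \<longleftrightarrow> p = q"
proof
  show "enc p = enc q \<Longrightarrow> p = q"
  proof (induction p arbitrary: q)
    case Nil
    then show ?case by (cases q) (auto split: if_splits)
  next
    case (Cons b p)
    have "enc (b # p) \<noteq> 0" by simp
    with Cons.prems obtain c r where q: "q = c # r" by (metis enc.simps(1) neq_Nil_conv)
    have "b = c \<and> enc p = enc r" using Cons.prems unfolding q
      by (auto split: if_splits; presburger)
    then show ?case using Cons.IH q by blast
  qed
qed simp

lemma enc_surj: "\<exists>p. enc p = n"
proof (induction n rule: less_induct)
  case (less n)
  show ?case
  proof (cases "n = 0")
    case True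
    then show ?thesis by (intro exI[of _ "[]"]) simp
  next
    case False
    then have "(n - 1) div 2 < n" by linarith
    then obtain p where p: "enc p = (n - 1) div 2" using less by blast
    show ?thesis
    proof (intro exI[of _ "even n # p"])
      show "enc (even n # p) = n" using False p by (auto elim!: evenE oddE)
    qed
  qed
qed

text \<open>The interface to computability in this direction: a partial machine becomes a total
  recursive \<open>T\<close> whose answers, once given, persist.\<close>

lemma computable2_clocked:
  assumes "computable2 U"
  obtains T where "recursive3 T" "\<And>s s' e x y. T s e x = Suc y \<Longrightarrow> s \<le> s' \<Longrightarrow> T s' e x = Suc y"
    "\<And>p x y. U p x = Some y \<longleftrightarrow> (\<exists>s. T s (enc p) (enc x) = Suc (enc y))"
proof -
  obtain f where f: "\<And>p x y. U p x = Some y \<longleftrightarrow> eval f [enc p, enc x] (enc y)"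
    using assms unfolding computable2_def by blast
  obtain t where t: "recursive t"
    "\<And>s xs. length xs = 2 \<Longrightarrow> t (prod_encode (s, tuple_encode xs)) = run f s xs"
    using recursive_run by blast
  have eq: "run f s [e, x] = t (prod_encode (s, prod_encode (e, prod_encode (x, 0))))" for s e x
    using t(2)[of "[e, x]" s] by simp
  have "recursive3 (\<lambda>s e x. run f s [e, x])"
    unfolding recursive3_def eq by (intro recursive_intros recursive_comp[OF t(1)])
  moreover have "U p x = Some y \<longleftrightarrow> (\<exists>s. run f s [enc p, enc x] = Suc (enc y))" for p x y
    using f run_sound run_complete by meson
  ultimately show ?thesis using that run_mono by blast
qed

text \<open>The program searches with \<open>Mn\<close> for the first stage with a nonzero value and
  evaluates \<open>G\<close> there again. All stages with a nonzero value agree, since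
  \<open>W p x\<close> has at most one value.\<close>

lemma computable2I:
  assumes "recursive3 G"
    and "\<And>p x y. W p x = Some y \<longleftrightarrow> (\<exists>s. G s (enc p) (enc x) = Suc (enc y))"
  shows "computable2 W"
proof -
  obtain g where "\<And>z. eval g [z] (G (pfst z) (pfst (psnd z)) (psnd (psnd z)))"
    using assms(1) unfolding recursive3_def recursive_def by blast
  from this[of "prod_encode (s, prod_encode (e, x))" for s e x]
  have g: "eval g [prod_encode (s, prod_encode (e, x))] (G s e x)" for s e x by simp
  obtain m where m: "\<And>x y. eval m [x, y] (x - y)"
    using recursive2_minus unfolding recursive2_def by blast
  obtain p where p: "\<And>x y. eval p [x, y] (prod_encode (x, y))"
    using recursive2_pair unfolding recursive2_def by blast
  define search where "search = Mn (Cn m [Cn S [Z], Cn g [Cn p [Id 0, Cn p [Id 1, Id 2]]]])"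
  define f where "f = Cn m [Cn g [Cn p [search, Cn p [Id 0, Id 1]]], Cn S [Z]]"
  have test: "eval (Cn m [Cn S [Z], Cn g [Cn p [Id 0, Cn p [Id 1, Id 2]]]]) [s, e, x] (Suc 0 - G s e x)" for s e x
    by (rule eval_Cn2 eval_Cn1 eval_S eval_Z m p g | (rule eval_Id_nth; simp))+
  have searchI: "eval search [e, x] s" if "0 < G s e x" "\<And>i. i < s \<Longrightarrow> G i e x = 0" for s e x
    unfolding search_def
  proof (rule eval_Mn)
    show "eval (Cn m [Cn S [Z], Cn g [Cn p [Id 0, Cn p [Id 1, Id 2]]]]) [s, e, x] 0"
      using test[of s e x] that(1) by (metis Suc_leI diff_is_0_eq)
    show "\<forall>i<s. \<exists>y. eval (Cn m [Cn S [Z], Cn g [Cn p [Id 0, Cn p [Id 1, Id 2]]]]) [i, e, x] y \<and> 0 < y"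
      using test[of _ e x] that(2) by (metis diff_zero zero_less_Suc)
  qed
  have searchD: "0 < G s e x" if "eval search [e, x] s" for e x s
  proof -
    from that have "eval (Cn m [Cn S [Z], Cn g [Cn p [Id 0, Cn p [Id 1, Id 2]]]]) [s, e, x] 0"
      unfolding search_def by (cases rule: eval.cases) auto
    from eval_deterministic[OF this test] show ?thesis by simp
  qed
  have fI: "eval f [e, x] (G s e x - Suc 0)" if "eval search [e, x] s" for e x s
    unfolding f_def
    by (rule that eval_Cn2 eval_Cn1 eval_S eval_Z m p g | (rule eval_Id_nth; simp))+
  \<comment> \<open>A composition has a value only if its arguments have one, so a value of
    \<open>f\<close> forces \<open>search\<close> to terminate; three nested compositions are taken
    apart.\<close>
  have fD: "\<exists>s. eval search [e, x] s" if "eval f [e, x] y" for e x y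
  proof -
    have "\<exists>zs. list_all2 (\<lambda>g. eval g xs) gs zs" if "eval (Cn a gs) xs y" for a gs xs y
      using that by (cases rule: eval.cases) auto
    note cn = this
    from cn[OF that[unfolded f_def]] obtain y where "eval (Cn g [Cn p [search, Cn p [Id 0, Id 1]]]) [e, x] y"
      by (auto simp: list_all2_Cons1)
    from cn[OF this] obtain y where "eval (Cn p [search, Cn p [Id 0, Id 1]]) [e, x] y"
      by (auto simp: list_all2_Cons1)
    from cn[OF this] show ?thesis by (auto simp: list_all2_Cons1)
  qed
  have "W q x = Some y \<longleftrightarrow> eval f [enc q, enc x] (enc y)" for q x y
  proof
    assume y: "W q x = Some y"
    let ?P = "\<lambda>s. 0 < G s (enc q) (enc x)"
    have "\<exists>s. ?P s" using y assms(2)[of q x y] by (metis zero_less_Suc)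
    then have P: "?P (LEAST s. ?P s)" by (rule LeastI_ex)
    have s: "eval search [enc q, enc x] (LEAST s. ?P s)"
      by (rule searchI[OF P]) (use not_less_Least in blast)
    obtain y' where y': "enc y' = G (LEAST s. ?P s) (enc q) (enc x) - 1" using enc_surj by blast
    then have "W q x = Some y'" using assms(2)[of q x y'] P by (metis Suc_diff_1)
    with y fI[OF s] y' show "eval f [enc q, enc x] (enc y)" by simp
  next
    assume y: "eval f [enc q, enc x] (enc y)"
    then obtain s where s: "eval search [enc q, enc x] s" using fD by blast
    have "enc y = G s (enc q) (enc x) - Suc 0" by (rule eval_deterministic[OF y fI[OF s]])
    with searchD[OF s] have "G s (enc q) (enc x) = Suc (enc y)" by simp
    then show "W q x = Some y" using assms(2) by blast
  qed
  then show ?thesis unfolding computable2_def by blast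
qed

section \<open>Binary strings and coin tossing\<close>

text \<open>\<open>Suc (enc p)\<close> has as binary digits a leading 1 above the bits of
  \<open>p\<close>, the first bit being least significant; hence its size determines the
  length.\<close>

lemma length_iff_enc: "length p = n \<longleftrightarrow> 2 ^ n \<le> Suc (enc p) \<and> Suc (enc p) < 2 ^ Suc n"
proof -
  have *: "2 ^ length p \<le> Suc (enc p) \<and> Suc (enc p) < 2 ^ Suc (length p)"
    by (induction p) auto
  show ?thesis
  proof
    assume n: "2 ^ n \<le> Suc (enc p) \<and> Suc (enc p) < 2 ^ Suc n"
    then have "(2::nat) ^ n < 2 ^ Suc (length p)" "(2::nat) ^ length p < 2 ^ Suc n"
      using * le_less_trans by blast+
    then have "n < Suc (length p)" "length p < Suc n"
      by (auto intro: power_less_imp_less_exp[of "2::nat"] simp del: power_Suc)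
    then show "length p = n" by simp
  qed (use * in blast)
qed

text \<open>The first toss is the least significant bit, so truncation to a prefix is reduction
  modulo a power of 2.\<close>

definition bval :: "(nat \<Rightarrow> bool) \<Rightarrow> nat \<Rightarrow> nat" where
  "bval \<pi> n = (\<Sum>i<n. of_bool (\<pi> i) * 2 ^ i)"

lemma bval_less: "bval \<pi> n < 2 ^ n"
  by (induction n) (auto simp: bval_def)

lemma bval_mod: "m \<le> n \<Longrightarrow> bval \<pi> n mod 2 ^ m = bval \<pi> m"
proof (induction rule: dec_induct)
  case base
  show ?case by (simp add: bval_less)
next
  case (step n)
  have "(2::nat) ^ n mod 2 ^ m = 0" using step by (simp add: le_imp_power_dvd)
  then have "bval \<pi> (Suc n) mod 2 ^ m = bval \<pi> n mod 2 ^ m"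
    by (simp add: bval_def) (metis add_0_right mod_add_right_eq)
  with step show ?case by simp
qed

lemma enc_snoc: "enc (p @ [b]) = enc p + (if b then 2 else 1) * 2 ^ length p"
  by (induction p) (auto simp: algebra_simps)

lemma Suc_enc_map_upt: "Suc (enc (map \<pi> [0..<n])) = 2 ^ n + bval \<pi> n"
proof (induction n)
  case 0
  show ?case by (simp add: bval_def)
next
  case (Suc n)
  have "Suc (enc (map \<pi> [0..<Suc n])) =
      Suc (enc (map \<pi> [0..<n])) + (if \<pi> n then 2 else 1) * 2 ^ n"
    by (simp add: enc_snoc)
  then show ?case unfolding Suc.IH by (simp add: bval_def)
qed

lemma string_of_value:
  assumes "N < 2 ^ n"
  obtains p where "length p = n" "Suc (enc p) = 2 ^ n + N"
proof -
  obtain p where "enc p = 2 ^ n + N - 1" using enc_surj by blast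
  then have p: "Suc (enc p) = 2 ^ n + N" by simp
  with assms have "length p = n" unfolding length_iff_enc by simp
  with p that show ?thesis by blast
qed

lemma space_cantor [simp]: "space cantor = UNIV"
  by (simp add: cantor_def space_PiM)

lemma prob_space_cantor: "prob_space cantor"
  unfolding cantor_def by (intro prob_space_PiM measure_pmf.prob_space_axioms)

lemma sets_cantor_cylinder: "{\<pi>. map \<pi> [0..<n] = p} \<in> sets cantor"
  and measure_cantor_cylinder: "length p = n \<Longrightarrow> measure cantor {\<pi>. map \<pi> [0..<n] = p} = (1/2) ^ n"
proof -
  interpret P: product_prob_space "\<lambda>_::nat. measure_pmf (bernoulli_pmf (1/2))" UNIV
    by unfold_locales
  let ?M = "\<lambda>_::nat. measure_pmf (bernoulli_pmf (1/2))"
  let ?C = "prod_emb UNIV ?M {..<n} (Pi\<^sub>E {..<n} (\<lambda>i. {p ! i}))"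
  have eq: "{\<pi>. map \<pi> [0..<n] = p} = ?C" if "length p = n"
  proof -
    have "map \<pi> [0..<n] = p \<longleftrightarrow> (\<forall>i<n. \<pi> i = p ! i)" for \<pi> :: "nat \<Rightarrow> bool"
      using that by (auto simp: list_eq_iff_nth_eq)
    then have "{\<pi>. map \<pi> [0..<n] = p} = {\<pi>. \<forall>i<n. \<pi> i = p ! i}" by simp
    also have "\<dots> = ?C"
      by (subst prod_emb_PiE) (simp, simp, fastforce simp: PiE_UNIV_domain Pi_iff split: if_splits)
    finally show ?thesis .
  qed
  show "{\<pi>. map \<pi> [0..<n] = p} \<in> sets cantor"
  proof (cases "length p = n")
    case True
    then show ?thesis unfolding eq[OF True] cantor_def by (intro measurable_prod_emb sets_PiM_I_finite) auto
  next
    case False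
    then have "{\<pi>. map \<pi> [0..<n] = p} = {}" by auto
    then show ?thesis by simp
  qed
  assume "length p = n"
  then have "measure cantor {\<pi>. map \<pi> [0..<n] = p} = measure cantor ?C" using eq by simp
  also have "\<dots> = (\<Prod>i<n. measure (?M i) {p ! i})"
    unfolding cantor_def by (rule P.measure_PiM_emb) auto
  also have "\<dots> = (\<Prod>i<n. 1/2)"
    by (rule prod.cong) (auto simp: measure_pmf_single)
  finally show "measure cantor {\<pi>. map \<pi> [0..<n] = p} = (1/2) ^ n" by simp
qed

text \<open>Events decided by the first \<open>n\<close> tosses are measured by counting, which
  turns comparisons of probabilities into comparisons of natural numbers.\<close>

lemma sets_cantor_bval: "{\<pi>. bval \<pi> n \<in> A} \<in> sets cantor"
  and measure_cantor_bval:
    "A \<subseteq> {..<2 ^ n} \<Longrightarrow> measure cantor {\<pi>. bval \<pi> n \<in> A} = card A / 2 ^ n"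
proof -
  interpret prob_space cantor by (rule prob_space_cantor)
  have cyl: "{\<pi>. bval \<pi> n = N} \<in> sets cantor \<and> measure cantor {\<pi>. bval \<pi> n = N} = (1/2) ^ n"
    if "N < 2 ^ n" for N
  proof -
    obtain p where p: "length p = n" "Suc (enc p) = 2 ^ n + N" using \<open>N < 2 ^ n\<close> by (rule string_of_value)
    have "bval \<pi> n = N \<longleftrightarrow> map \<pi> [0..<n] = p" for \<pi>
      using Suc_enc_map_upt[of \<pi> n] p(2)
      by (metis add_left_cancel enc_inject nat.inject)
    then show ?thesis using sets_cantor_cylinder measure_cantor_cylinder[OF p(1)] by simp
  qed
  have *: "{\<pi>. bval \<pi> n \<in> A} = (\<Union>N\<in>A \<inter> {..<2 ^ n}. {\<pi>. bval \<pi> n = N})"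
    using bval_less by auto
  show "{\<pi>. bval \<pi> n \<in> A} \<in> sets cantor"
    unfolding * using cyl by (intro sets.finite_UN) auto
  assume A: "A \<subseteq> {..<2 ^ n}"
  then have fin: "finite A" using finite_subset by blast
  have "{\<pi>. bval \<pi> n \<in> A} = (\<Union>N\<in>A. {\<pi>. bval \<pi> n = N})" by auto
  also have "measure cantor \<dots> = (\<Sum>N\<in>A. measure cantor {\<pi>. bval \<pi> n = N})"
    using cyl A fin by (intro finite_measure_finite_Union) (auto simp: disjoint_family_on_def)
  also have "\<dots> = (\<Sum>N\<in>A. (1/2) ^ n)" using cyl A by (intro sum.cong) auto
  finally show "measure cantor {\<pi>. bval \<pi> n \<in> A} = card A / 2 ^ n" by (simp add: power_divide)
qed

section \<open>Clocked approximation of the output probabilities\<close>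

locale clocked_machine =
  fixes U :: "bool list \<Rightarrow> bool list \<Rightarrow> bool list option" and T :: "nat \<Rightarrow> nat \<Rightarrow> nat \<Rightarrow> nat"
  assumes prefix_free: "prefix_free2 U"
    and recursive3_T: "recursive3 T"
    and T_mono: "T s e a = Suc b \<Longrightarrow> s \<le> s' \<Longrightarrow> T s' e a = Suc b"
    and U_iff: "U p x = Some y \<longleftrightarrow> (\<exists>s. T s (enc p) (enc x) = Suc (enc y))"
begin

text \<open>\<open>N\<close> stands for the first \<open>s\<close> tosses, and
  \<open>2 ^ n + N mod 2 ^ n - 1\<close> is the code of their prefix of length
  \<open>n\<close>.\<close>

definition hit :: "nat \<Rightarrow> nat \<Rightarrow> nat \<Rightarrow> nat \<Rightarrow> bool" where
  "hit s x y N \<longleftrightarrow> (\<exists>n\<le>s. T s (2 ^ n + N mod 2 ^ n - 1) x = Suc y)"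

definition outp :: "nat \<Rightarrow> nat \<Rightarrow> real" where
  "outp x y = measure cantor {\<pi>. \<exists>s. hit s x y (bval \<pi> s)}"

text \<open>The probability of output \<open>y\<close> observed by time \<open>s\<close> is at least
  \<open>2^-k\<close>, with denominators cleared to make the condition decidable.\<close>

definition heavy :: "nat \<Rightarrow> nat \<Rightarrow> nat \<Rightarrow> nat \<Rightarrow> bool" where
  "heavy x y k s \<longleftrightarrow> 2 ^ s \<le> 2 ^ k * (\<Sum>N<2 ^ s. of_bool (hit s x y N) :: nat)"

lemma hit_bval: "hit s x y (bval \<pi> s) \<longleftrightarrow> (\<exists>n\<le>s. T s (enc (map \<pi> [0..<n])) x = Suc y)"
proof -
  have "2 ^ n + bval \<pi> s mod 2 ^ n - 1 = enc (map \<pi> [0..<n])" if "n \<le> s" for n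
    using Suc_enc_map_upt[of \<pi> n] bval_mod[OF that] by simp
  then show ?thesis unfolding hit_def by auto
qed

lemma hit_mono: "hit s x y (bval \<pi> s) \<Longrightarrow> s \<le> s' \<Longrightarrow> hit s' x y (bval \<pi> s')"
  unfolding hit_bval using T_mono le_trans by blast

lemma runs_iff_hit: "runs U \<pi> x y \<longleftrightarrow> (\<exists>s. hit s (enc x) (enc y) (bval \<pi> s))"
proof
  assume "runs U \<pi> x y"
  then obtain n s where "T s (enc (map \<pi> [0..<n])) (enc x) = Suc (enc y)"
    unfolding runs_def U_iff by blast
  then have "T (max n s) (enc (map \<pi> [0..<n])) (enc x) = Suc (enc y)" by (rule T_mono) simp
  then show "\<exists>s. hit s (enc x) (enc y) (bval \<pi> s)" unfolding hit_bval by (metis max.cobounded1)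
qed (auto simp: runs_def U_iff hit_bval)

lemma sets_hit: "{\<pi>. hit s x y (bval \<pi> s)} \<in> sets cantor"
  using sets_cantor_bval[of s "{N. hit s x y N}"] by simp

lemma sets_outp: "{\<pi>. \<exists>s. hit s x y (bval \<pi> s)} \<in> sets cantor"
proof -
  have "{\<pi>. \<exists>s. hit s x y (bval \<pi> s)} = (\<Union>s. {\<pi>. hit s x y (bval \<pi> s)})" by auto
  then show ?thesis using sets_hit by auto
qed

lemma measure_hit:
  "measure cantor {\<pi>. hit s x y (bval \<pi> s)} = (\<Sum>N<2 ^ s. of_bool (hit s x y N) :: nat) / 2 ^ s"
proof -
  have "{\<pi>. hit s x y (bval \<pi> s)} = {\<pi>. bval \<pi> s \<in> {N \<in> {..<2 ^ s}. hit s x y N}}"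
    using bval_less by auto
  then have "measure cantor {\<pi>. hit s x y (bval \<pi> s)} = card {N \<in> {..<2 ^ s}. hit s x y N} / 2 ^ s"
    using measure_cantor_bval[of "{N \<in> {..<2 ^ s}. hit s x y N}" s] by auto
  moreover have "card {N \<in> {..<2 ^ s}. hit s x y N} = (\<Sum>N<2 ^ s. of_bool (hit s x y N) :: nat)"
    by (simp add: of_bool_def sum.If_cases Int_def)
  ultimately show ?thesis by simp
qed

lemma heavy_iff: "heavy x y k s \<longleftrightarrow> (1/2) ^ k \<le> measure cantor {\<pi>. hit s x y (bval \<pi> s)}"
proof -
  define c where "c = (\<Sum>N<2 ^ s. of_bool (hit s x y N) :: nat)"
  have "heavy x y k s \<longleftrightarrow> real (2 ^ s) \<le> real (2 ^ k * c)"
    unfolding heavy_def c_def of_nat_le_iff ..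
  also have "\<dots> \<longleftrightarrow> (1/2) ^ k \<le> real c / 2 ^ s" by (simp add: field_simps)
  finally show ?thesis unfolding measure_hit c_def .
qed

lemma outp_nonneg: "0 \<le> outp x y"
  by (simp add: outp_def)

lemma heavy_imp_outp:
  assumes "heavy x y k s"
  shows "(1/2) ^ k \<le> outp x y"
proof -
  interpret prob_space cantor by (rule prob_space_cantor)
  have "measure cantor {\<pi>. hit s x y (bval \<pi> s)} \<le> outp x y"
    unfolding outp_def by (rule finite_measure_mono[OF _ sets_outp]) auto
  with assms show ?thesis unfolding heavy_iff by simp
qed

text \<open>Continuity from below along increasing events. Strictness matters: the approximations
  may stay below a limit equal to \<open>(1/2) ^ k\<close>. The bound persists, so two observations
  can be made at a common time.\<close>

lemma outp_imp_heavy: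
  assumes "(1/2) ^ k < outp x y"
  shows "\<exists>s. \<forall>s'\<ge>s. heavy x y k s'"
proof -
  interpret prob_space cantor by (rule prob_space_cantor)
  let ?E = "\<lambda>s. {\<pi>. hit s x y (bval \<pi> s)}"
  have "incseq ?E" using hit_mono by (intro monoI) blast
  moreover have "range ?E \<subseteq> sets cantor" using sets_hit by auto
  ultimately have "(\<lambda>s. measure cantor (?E s)) \<longlonglongrightarrow> measure cantor (\<Union>s. ?E s)"
    by (intro finite_Lim_measure_incseq)
  moreover have "(\<Union>s. ?E s) = {\<pi>. \<exists>s. hit s x y (bval \<pi> s)}" by auto
  ultimately have "(\<lambda>s. measure cantor (?E s)) \<longlonglongrightarrow> outp x y" by (simp add: outp_def)
  then have "\<forall>\<^sub>F s in sequentially. (1/2) ^ k < measure cantor (?E s)"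
    using assms by (rule order_tendstoD)
  then show ?thesis unfolding heavy_iff eventually_sequentially using less_imp_le by blast
qed

lemma outp_runs: "outp (enc x) (enc y) = measure cantor {\<pi>. runs U \<pi> x y}"
  by (simp add: outp_def runs_iff_hit)

text \<open>Halting prefixes of one sequence are comparable, so prefix-freeness allows only
  one.\<close>

lemma runs_unique:
  assumes "runs U \<pi> x y" "runs U \<pi> x z"
  shows "y = z"
proof -
  obtain m n where m: "U (map \<pi> [0..<m]) x = Some y" and n: "U (map \<pi> [0..<n]) x = Some z"
    using assms unfolding runs_def by blast
  have "strict_prefix (map \<pi> [0..<i]) (map \<pi> [0..<j])" if "i < j" for i j
  proof -
    have "[0..<j] = [0..<i] @ [i..<j]"
      using that upt_add_eq_append[of 0 i "j - i"] by simp
    then show ?thesis using that by (auto simp: strict_prefix_def)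
  qed
  then have "m = n" using prefix_free m n unfolding prefix_free2_def
    by (metis linorder_neqE_nat option.distinct(1))
  with m n show ?thesis by simp
qed

lemma sum_outp_le:
  assumes "finite Y"
  shows "(\<Sum>y\<in>Y. outp x y) \<le> 1"
proof -
  interpret prob_space cantor by (rule prob_space_cantor)
  obtain x' where x': "enc x' = x" using enc_surj by blast
  let ?E = "\<lambda>y. {\<pi>. \<exists>s. hit s x y (bval \<pi> s)}"
  have "disjoint_family_on ?E Y"
  proof (unfold disjoint_family_on_def, intro ballI impI)
    fix y z :: nat assume "y \<noteq> z"
    obtain y' z' where yz: "y = enc y'" "z = enc z'" using enc_surj by metis
    with \<open>y \<noteq> z\<close> have "y' \<noteq> z'" by blast
    then show "?E y \<inter> ?E z = {}"
      unfolding yz x'[symmetric] runs_iff_hit[symmetric] using runs_unique by blast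
  qed
  then have "(\<Sum>y\<in>Y. outp x y) = measure cantor (\<Union>y\<in>Y. ?E y)"
    unfolding outp_def using sets_outp assms by (intro finite_measure_finite_Union[symmetric]) auto
  then show ?thesis by simp
qed

lemma decidable_heavy:
  assumes "recursive a" "recursive b" "recursive c" "recursive d"
  shows "decidable (\<lambda>z. heavy (a z) (b z) (c z) (d z))"
  unfolding heavy_def hit_def
  by (intro recursive_intros recursive3_comp[OF recursive3_T] assms
      recursive_comp[OF assms(1)] recursive_comp[OF assms(2)] recursive_comp[OF assms(3)]
      recursive_comp[OF assms(4)])

end

section \<open>Machines from enumerations\<close>

text \<open>\<open>G s (enc p) x = Suc y\<close> declares at stage \<open>s\<close> that
  \<open>p\<close> outputs \<open>y\<close> on \<open>x\<close>. For \<open>p = q\<close> the second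
  assumption makes the result single-valued; otherwise it makes it prefix-free.\<close>

lemma machine_from_enumeration:
  assumes "recursive3 G"
    and "\<And>p q s s' x y y'. G s (enc p) x = Suc y \<Longrightarrow> G s' (enc q) x = Suc y' \<Longrightarrow> prefix p q \<Longrightarrow> p = q \<and> y = y'"
  shows "\<exists>W. prefix_free2 W \<and> computable2 W \<and>
    (\<forall>p x y. W p x = Some y \<longleftrightarrow> (\<exists>s. G s (enc p) (enc x) = Suc (enc y)))"
proof -
  let ?P = "\<lambda>p x y. \<exists>s. G s (enc p) (enc x) = Suc (enc y)"
  define W where "W p x = (if \<exists>y. ?P p x y then Some (SOME y. ?P p x y) else None)" for p x
  have uniq: "y = y'" if "?P p x y" "?P p x y'" for p x y y'
    using that assms(2) by (metis enc_inject prefix_order.refl)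
  have W: "W p x = Some y \<longleftrightarrow> ?P p x y" for p x y
  proof
    assume "W p x = Some y"
    then have "\<exists>y. ?P p x y" "y = (SOME y. ?P p x y)" by (auto simp: W_def split: if_splits)
    then show "?P p x y" using someI_ex[of "?P p x"] by blast
  next
    assume y: "?P p x y"
    then have "?P p x (SOME y. ?P p x y)" by (rule someI[of "?P p x"])
    with y uniq have "(SOME y. ?P p x y) = y" by blast
    with y show "W p x = Some y" unfolding W_def by auto
  qed
  have "prefix_free2 W"
    unfolding prefix_free2_def
  proof (intro allI impI notI)
    fix x p q
    assume "W p x \<noteq> None \<and> W q x \<noteq> None" and pq: "strict_prefix p q"
    then obtain y z where "W p x = Some y" "W q x = Some z" by auto
    then have "p = q" using assms(2) pq unfolding W by (metis prefix_order.less_imp_le)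
    with pq show False by simp
  qed
  moreover have "computable2 W" using assms(1) W by (rule computable2I)
  ultimately show ?thesis using W by blast
qed

text \<open>Ensures that the \<open>LEAST\<close> in \<open>KP\<close> is attained. A machine that
  maps \<open>s\<close> zeros followed by a one to the string with code \<open>s\<close> is
  prefix-free, and optimality transfers its programs to \<open>V\<close>.\<close>

lemma ex_program:
  assumes "kp_optimal V"
  shows "\<exists>q. V q x = Some y"
proof -
  \<comment> \<open>\<open>2 ^ Suc s + 2 ^ s - 1\<close> is the code of \<open>s\<close> zeros
    followed by a one.\<close>
  define G where "G s e x = (if Suc e = 2 ^ Suc s + 2 ^ s then Suc s else 0)" for s e x :: nat
  have code: "p = replicate s False @ [True]" if "G s (enc p) x = Suc y" for s p x y
  proof -
    have "Suc (enc (replicate s False @ [True])) = 2 ^ Suc s + 2 ^ s"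
    proof -
      have "Suc (enc (replicate s False)) = 2 ^ s" by (induction s) auto
      then show ?thesis by (simp add: enc_snoc)
    qed
    with that show ?thesis unfolding G_def by (metis enc_inject nat.distinct(1) nat.inject)
  qed
  have "recursive3 G" unfolding recursive3_def G_def by (intro recursive_intros)
  moreover have "p = q \<and> y = y'"
    if G: "G s (enc p) x = Suc y" "G s' (enc q) x = Suc y'" and "prefix p q" for p q s s' x y y'
  proof -
    have pq: "p = replicate s False @ [True]" "q = replicate s' False @ [True]"
      using code G by blast+
    have "p = q"
    proof (rule ccontr)
      assume "p \<noteq> q"
      then have "prefix p (replicate s' False)" using \<open>prefix p q\<close> pq(2) by simp
      then have "set p \<subseteq> {False}" using set_mono_prefix by fastforce
      then show False using pq(1) by simp
    qed
    then have "s = s'" using pq by (metis length_append_singleton length_replicate nat.inject)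
    with G show ?thesis using \<open>p = q\<close> by (auto simp: G_def split: if_splits)
  qed
  ultimately have "\<exists>W. prefix_free2 W \<and> computable2 W \<and>
      (\<forall>p x y. W p x = Some y \<longleftrightarrow> (\<exists>s. G s (enc p) (enc x) = Suc (enc y)))"
    by (rule machine_from_enumeration)
  then obtain W where W: "prefix_free2 W" "computable2 W"
    "\<And>p x y. W p x = Some y \<longleftrightarrow> (\<exists>s. G s (enc p) (enc x) = Suc (enc y))"
    by blast
  obtain p where "enc p = 2 ^ Suc (enc y) + 2 ^ enc y - 1" using enc_surj by blast
  then have "G (enc y) (enc p) (enc x) = Suc (enc y)" by (simp add: G_def)
  then have "W p x = Some y" using W(3) by blast
  then show ?thesis using assms W(1,2) unfolding kp_optimal_def by blast
qed

lemma KP_program: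
  assumes "kp_optimal V"
  obtains p where "length p = KP V y x" "V p x = Some y"
proof -
  have "\<exists>n p. length p = n \<and> V p x = Some y" using ex_program[OF assms] by blast
  then have "\<exists>p. length p = KP V y x \<and> V p x = Some y" unfolding KP_def by (rule LeastI_ex)
  with that show ?thesis by blast
qed

lemma KP_le: "V p x = Some y \<Longrightarrow> KP V y x \<le> length p"
  unfolding KP_def by (rule Least_le) blast

section \<open>Requests\<close>

text \<open>The exponents are distinct, so a geometric series starting at the smallest one
  dominates.\<close>

lemma sum_half_powers_le:
  assumes "finite K" "\<And>k. k \<in> K \<Longrightarrow> (1/2::real) ^ k \<le> m" "0 \<le> m"
  shows "(\<Sum>k\<in>K. (1/2::real) ^ k) \<le> 2 * m"
proof (cases "K = {}")
  case True
  then show ?thesis using assms(3) by simp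
next
  case False
  have geo: "(\<Sum>k=a..b. (1/2::real) ^ k) \<le> 2 * (1/2) ^ a" for a b :: nat
  proof -
    have "(\<Sum>k=a..<a+n. (1/2::real) ^ k) = 2 * (1/2) ^ a - 2 * (1/2) ^ (a + n)" for n
      by (induction n) auto
    from this[of "Suc b - a"] have "a \<le> Suc b \<Longrightarrow> ?thesis"
      by (simp add: atLeastLessThanSuc_atLeastAtMost)
    then show ?thesis by (cases "a \<le> Suc b") auto
  qed
  have "(\<Sum>k\<in>K. (1/2::real) ^ k) \<le> (\<Sum>k=Min K..Max K. (1/2::real) ^ k)"
    using assms(1) by (intro sum_mono2) auto
  also have "\<dots> \<le> 2 * (1/2) ^ Min K" by (rule geo)
  also have "\<dots> \<le> 2 * m" using assms(2)[of "Min K"] assms(1) False by simp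
  finally show ?thesis .
qed

text \<open>A Kraft-type bound: the requests with the same \<open>u t\<close> have distinct
  exponents and total weight at most \<open>2 * m (u t)\<close>; the total mass is at most
  1.\<close>

lemma sum_request_weights_le:
  fixes m :: "nat \<Rightarrow> real" and u k :: "nat \<Rightarrow> nat"
  assumes "finite F" "inj_on (\<lambda>t. (u t, k t)) F" "\<And>t. t \<in> F \<Longrightarrow> (1/2) ^ k t \<le> m (u t)"
    and "\<And>v. 0 \<le> m v" "\<And>Y. finite Y \<Longrightarrow> (\<Sum>v\<in>Y. m v) \<le> 1"
  shows "(\<Sum>t\<in>F. (1/2::real) ^ k t) \<le> 2"
proof -
  have "(\<Sum>t\<in>F. (1/2::real) ^ k t) = (\<Sum>v\<in>u ` F. \<Sum>t | t \<in> F \<and> u t = v. (1/2) ^ k t)"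
    using assms(1) by (rule sum.image_gen)
  also have "\<dots> \<le> (\<Sum>v\<in>u ` F. 2 * m v)"
  proof (rule sum_mono)
    fix v
    let ?F = "{t. t \<in> F \<and> u t = v}"
    have "inj_on k ?F" using assms(2) by (auto simp: inj_on_def)
    then have "(\<Sum>t\<in>?F. (1/2::real) ^ k t) = (\<Sum>j\<in>k ` ?F. (1/2) ^ j)"
      by (simp add: sum.reindex)
    also have "\<dots> \<le> 2 * m v"
      using assms(1,3,4) by (intro sum_half_powers_le) auto
    finally show "(\<Sum>t\<in>?F. (1/2::real) ^ k t) \<le> 2 * m v" .
  qed
  also have "\<dots> \<le> 2" using assms(5)[of "u ` F"] assms(1) by (simp flip: sum_distrib_left)
  finally show ?thesis .
qed

text \<open>A stage number codes a request \<open>(x, y, k)\<close> together with a time \<open>s\<close>. The request is issued at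
  the first time at which its condition \<open>Q\<close> is observed, hence at one stage only.\<close>

abbreviation rx :: "nat \<Rightarrow> nat" where "rx t \<equiv> pfst t"
abbreviation ry :: "nat \<Rightarrow> nat" where "ry t \<equiv> pfst (psnd t)"
abbreviation rk :: "nat \<Rightarrow> nat" where "rk t \<equiv> pfst (psnd (psnd t))"
abbreviation rs :: "nat \<Rightarrow> nat" where "rs t \<equiv> psnd (psnd (psnd t))"

definition issued :: "(nat \<Rightarrow> nat \<Rightarrow> nat \<Rightarrow> nat \<Rightarrow> bool) \<Rightarrow> nat \<Rightarrow> bool" where
  "issued Q t \<longleftrightarrow> Q (rx t) (ry t) (rk t) (rs t) \<and> (\<forall>s<rs t. \<not> Q (rx t) (ry t) (rk t) s)"

text \<open>The stage number bounds the exponent, so a weight \<open>2^-(rk t)\<close> becomes an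
  integer after scaling by \<open>2 ^ t\<close>.\<close>

lemma rk_le: "rk t \<le> t"
  by (metis le_prod_encode_1 le_prod_encode_2 le_trans prod.collapse prod_decode_inverse)

lemma issued_inject:
  assumes "issued Q t" "issued Q t'" "rx t = rx t'" "ry t = ry t'" "rk t = rk t'"
  shows "t = t'"
proof -
  have "rs t = rs t'"
    using assms unfolding issued_def by (metis linorder_neqE_nat)
  with assms(3-5) have "prod_decode t = prod_decode t'"
    by (metis prod.expand prod_decode_eq)
  then show ?thesis by simp
qed

lemma issued_exists:
  assumes "Q x y k s"
  obtains t where "issued Q t" "rx t = x" "ry t = y" "rk t = k"
proof -
  obtain s' where s': "Q x y k s'" "\<forall>s<s'. \<not> Q x y k s"
    using exists_least_iff[of "Q x y k"] assms by blast
  let ?t = "prod_encode (x, prod_encode (y, prod_encode (k, s')))"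
  have "issued Q ?t" unfolding issued_def using s' by simp
  then show ?thesis using that[of ?t] by simp
qed

lemma sum_issued_rx_le:
  fixes m :: "nat \<Rightarrow> real"
  assumes "finite F" "\<And>t. t \<in> F \<Longrightarrow> issued Q t \<and> rx t = v" "\<And>y k s. Q v y k s \<Longrightarrow> (1/2) ^ k \<le> m y"
    and "\<And>y. 0 \<le> m y" "\<And>Y. finite Y \<Longrightarrow> (\<Sum>y\<in>Y. m y) \<le> 1"
  shows "(\<Sum>t\<in>F. (1/2::real) ^ rk t) \<le> 2"
proof (rule sum_request_weights_le[where u = ry and m = m])
  show "inj_on (\<lambda>t. (ry t, rk t)) F"
    by (rule inj_onI, rule issued_inject[of Q]) (use assms(2) in auto)
  show "(1/2) ^ rk t \<le> m (ry t)" if "t \<in> F" for t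
    using assms(2)[OF that] assms(3) unfolding issued_def by blast
qed (use assms in auto)

lemma sum_issued_ry_le:
  fixes m :: "nat \<Rightarrow> real"
  assumes "finite F" "\<And>t. t \<in> F \<Longrightarrow> issued Q t \<and> ry t = v" "\<And>x k s. Q x v k s \<Longrightarrow> (1/2) ^ k \<le> m x"
    and "\<And>x. 0 \<le> m x" "\<And>X. finite X \<Longrightarrow> (\<Sum>x\<in>X. m x) \<le> 1"
  shows "(\<Sum>t\<in>F. (1/2::real) ^ rk t) \<le> 2"
proof (rule sum_request_weights_le[where u = rx and m = m])
  show "inj_on (\<lambda>t. (rx t, rk t)) F"
    by (rule inj_onI, rule issued_inject[of Q]) (use assms(2) in auto)
  show "(1/2) ^ rk t \<le> m (rx t)" if "t \<in> F" for t
    using assms(2)[OF that] assms(3) unfolding issued_def by blast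
qed (use assms in auto)

lemma decidable_issued:
  assumes "\<And>a b c d. recursive a \<Longrightarrow> recursive b \<Longrightarrow> recursive c \<Longrightarrow> recursive d \<Longrightarrow>
      decidable (\<lambda>z. Q (a z) (b z) (c z) (d z))"
    and "recursive f"
  shows "decidable (\<lambda>z. issued Q (f z))"
  unfolding issued_def by (intro recursive_intros assms recursive_comp[OF assms(2)])

section \<open>The coding theorem\<close>

text \<open>The bit order is opposite to that of \<open>bval\<close>: the first bit is most
  significant, so \<open>p\<close> names the dyadic interval number \<open>msb p\<close> of length
  \<open>2^-(length p)\<close> and prefixes name larger intervals.\<close>

primrec msb :: "bool list \<Rightarrow> nat" where
  "msb [] = 0"
| "msb (b # p) = of_bool b * 2 ^ length p + msb p"

lemma msb_less: "msb p < 2 ^ length p"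
  by (induction p) auto

lemma msb_append: "msb (p @ q) = msb p * 2 ^ length q + msb q"
  by (induction p) (auto simp: algebra_simps power_add)

lemma msb_surj: "N < 2 ^ n \<Longrightarrow> \<exists>p. length p = n \<and> msb p = N"
proof (induction n arbitrary: N)
  case (Suc n)
  have "N mod 2 ^ n < 2 ^ n" by simp
  then obtain p where p: "length p = n" "msb p = N mod 2 ^ n" using Suc.IH by blast
  have "N div 2 ^ n < 2" using Suc.prems by (simp add: less_mult_imp_div_less)
  then have "of_bool (N div 2 ^ n = 1) = N div 2 ^ n" by auto
  then have "msb ((N div 2 ^ n = 1) # p) = N" by (simp only: msb.simps p div_mult_mod_eq)
  then show ?case using p(1) by (metis length_Cons)
qed simp

text \<open>Reversal of the bit order in arithmetic: digit \<open>i\<close> of the code moves to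
  position \<open>n - 1 - i\<close>. This form makes \<open>msb\<close> accessible to the closure
  rules.\<close>

lemma msb_eq_sum:
  "length p = n \<Longrightarrow> msb p = (\<Sum>i<n. (Suc (enc p) - 2 ^ n) div 2 ^ i mod 2 * 2 ^ (n - 1 - i))"
proof (induction p arbitrary: n)
  case (Cons b p)
  define m where "m = length p"
  define M where "M = Suc (enc p) - 2 ^ m"
  have n: "n = Suc m" using Cons.prems m_def by simp
  have "2 ^ m \<le> Suc (enc p)" using length_iff_enc m_def by blast
  then have M: "Suc (enc (b # p)) - 2 ^ n = of_bool b + 2 * M" unfolding n M_def by auto
  have "(\<Sum>i<n. (of_bool b + 2 * M) div 2 ^ i mod 2 * 2 ^ (n - 1 - i)) =
      of_bool b * 2 ^ m + (\<Sum>i<m. (of_bool b + 2 * M) div 2 ^ Suc i mod 2 * 2 ^ (m - 1 - i))"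
    unfolding n by (subst sum.lessThan_Suc_shift) simp
  also have "(\<Sum>i<m. (of_bool b + 2 * M) div 2 ^ Suc i mod 2 * 2 ^ (m - 1 - i)) =
      (\<Sum>i<m. M div 2 ^ i mod 2 * 2 ^ (m - 1 - i))"
    by (intro sum.cong refl) (simp add: div_mult2_eq)
  also have "\<dots> = msb p" using Cons.IH[OF m_def[symmetric]] M_def by simp
  finally show ?case unfolding M by (simp add: m_def)
qed simp

context clocked_machine
begin

definition earlier :: "nat \<Rightarrow> nat set" where
  "earlier t = {t'. t' < t \<and> issued heavy t' \<and> rx t' = rx t}"

definition offset :: "nat \<Rightarrow> nat" where
  "offset t = (\<Sum>t'<t. if issued heavy t' \<and> rx t' = rx t then 2 ^ (t - rk t') else 0)"

text \<open>Request \<open>t\<close> owns the real interval of length \<open>2^-(rk t + 1)\<close> that begins at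
  \<open>offset t / 2^(t + 1)\<close>; it contains the dyadic interval number \<open>slot t\<close> of half that length.\<close>

definition slot :: "nat \<Rightarrow> nat" where
  "slot t = (offset t * 2 ^ (rk t + 2) + (2 ^ (t + 1) - 1)) div 2 ^ (t + 1)"

definition left_end :: "nat \<Rightarrow> real" where
  "left_end t = (\<Sum>t'\<in>earlier t. (1/2) ^ rk t') / 2"

lemma finite_earlier: "finite (earlier t)"
  by (simp add: earlier_def)

lemma offset_eq: "real (offset t) = left_end t * 2 ^ (t + 1)"
proof -
  have "offset t = (\<Sum>t'\<in>earlier t. 2 ^ (t - rk t'))"
    unfolding offset_def earlier_def by (simp add: sum.If_cases Int_def)
  then have "real (offset t) = (\<Sum>t'\<in>earlier t. 2 ^ (t - rk t'))" by simp
  also have "\<dots> = (\<Sum>t'\<in>earlier t. (1/2) ^ rk t' * 2 ^ t)"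
  proof (rule sum.cong)
    fix t' assume "t' \<in> earlier t"
    \<comment> \<open>Hence the subtraction \<open>t - rk t'\<close> in \<open>offset\<close> does
      not truncate.\<close>
    then have "rk t' \<le> t" using rk_le[of t'] by (simp add: earlier_def)
    then show "2 ^ (t - rk t') = (1/2::real) ^ rk t' * 2 ^ t"
      by (simp add: power_diff power_divide)
  qed simp
  also have "\<dots> = (\<Sum>t'\<in>earlier t. (1/2) ^ rk t') * 2 ^ t" by (rule sum_distrib_right[symmetric])
  finally show ?thesis by (simp add: left_end_def)
qed

text \<open>\<open>slot t\<close> is the ceiling of \<open>left_end t * 2 ^ (rk t + 2)\<close>.
  Rounding up costs at most one unit \<open>2^-(rk t + 2)\<close>, and the owned interval is two
  units long.\<close>

lemma slot_bounds:
  "left_end t \<le> slot t / 2 ^ (rk t + 2)"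
  "(slot t + 1) / 2 ^ (rk t + 2) \<le> left_end t + (1/2) ^ rk t / 2"
proof -
  define n where "n = offset t * 2 ^ (rk t + 2)"
  define d where "d = (2::nat) ^ (t + 1)"
  have d: "0 < d" by (simp add: d_def)
  have "slot t * d + (n + (d - 1)) mod d = n + (d - 1)"
    unfolding slot_def n_def d_def by (rule div_mult_mod_eq)
  moreover have "(n + (d - 1)) mod d \<le> d - 1" using d by (metis Suc_pred' less_Suc_eq_le mod_less_divisor)
  ultimately have "n \<le> slot t * d" "slot t * d \<le> n + d" by linarith+
  then have "real n \<le> real (slot t * d)" "real (slot t * d) \<le> real (n + d)" by (simp_all only: of_nat_le_iff)
  then have "left_end t * 2 ^ (rk t + 2) * d \<le> slot t * d" "slot t * d \<le> (left_end t * 2 ^ (rk t + 2) + 1) * d"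
    unfolding n_def by (simp_all add: offset_eq d_def algebra_simps)
  then have *: "left_end t * 2 ^ (rk t + 2) \<le> slot t" "slot t \<le> left_end t * 2 ^ (rk t + 2) + 1"
    using d by (simp_all add: mult_le_cancel_right)
  show "left_end t \<le> slot t / 2 ^ (rk t + 2)" using *(1) by (simp add: pos_le_divide_eq)
  have "(slot t + 1) / 2 ^ (rk t + 2) \<le> (left_end t * 2 ^ (rk t + 2) + 2) / 2 ^ (rk t + 2)"
    using *(2) by (intro divide_right_mono) auto
  also have "\<dots> = left_end t + (1/2) ^ rk t / 2" by (simp add: field_simps)
  finally show "(slot t + 1) / 2 ^ (rk t + 2) \<le> left_end t + (1/2) ^ rk t / 2" .
qed

lemma left_end_step:
  assumes "issued heavy t" "rx t' = rx t" "t < t'"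
  shows "left_end t + (1/2) ^ rk t / 2 \<le> left_end t'"
proof -
  have "(\<Sum>i\<in>insert t (earlier t). (1/2::real) ^ rk i) \<le> (\<Sum>i\<in>earlier t'. (1/2) ^ rk i)"
    using assms by (intro sum_mono2 finite_earlier) (auto simp: earlier_def)
  moreover have "t \<notin> earlier t" by (simp add: earlier_def)
  ultimately show ?thesis by (simp add: left_end_def finite_earlier)
qed

text \<open>The factor 1/2 in \<open>left_end\<close> offsets the bound 2 on the total
  weight.\<close>

lemma right_end_le:
  assumes "issued heavy t"
  shows "left_end t + (1/2) ^ rk t / 2 \<le> 1"
proof -
  have "(\<Sum>i\<in>insert t (earlier t). (1/2::real) ^ rk i) \<le> 2"
    by (rule sum_issued_rx_le[where Q = heavy and v = "rx t" and m = "outp (rx t)"])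
      (use assms heavy_imp_outp outp_nonneg sum_outp_le finite_earlier in \<open>auto simp: earlier_def\<close>)
  moreover have "t \<notin> earlier t" by (simp add: earlier_def)
  ultimately show ?thesis by (simp add: left_end_def finite_earlier)
qed

text \<open>A prefix relation would nest the two dyadic intervals, but distinct requests with the
  same \<open>rx\<close> own intervals without common interior.\<close>

lemma slot_prefix:
  assumes t: "issued heavy t" "length p = rk t + 2" "msb p = slot t"
    and t': "issued heavy t'" "length q = rk t' + 2" "msb q = slot t'"
    and "rx t = rx t'" "prefix p q"
  shows "t = t'" "p = q"
proof -
  obtain r where r: "q = p @ r" using assms(8) by (auto simp: prefix_def)
  have sep: "(slot i + 1) / 2 ^ (rk i + 2) \<le> slot j / 2 ^ (rk j + 2)"
    if "i < j" "issued heavy i" "rx i = rx j" for i j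
    using slot_bounds(2)[of i] left_end_step[of i j] slot_bounds(1)[of j] that by linarith
  have q: "msb q = msb p * 2 ^ length r + msb r" "length q = length p + length r"
    by (simp_all add: r msb_append)
  have "msb p * 2 ^ length r \<le> msb q" "msb q < (msb p + 1) * 2 ^ length r"
    using msb_less[of r] by (simp_all add: q)
  then have "real (msb p * 2 ^ length r) \<le> real (msb q)" "real (msb q) < real ((msb p + 1) * 2 ^ length r)"
    by (simp_all only: of_nat_le_iff of_nat_less_iff)
  then have "msb p / 2 ^ length p \<le> msb q / 2 ^ length q" "msb q / 2 ^ length q < (msb p + 1) / 2 ^ length p"
    by (simp_all add: q(2) power_add field_simps)
  then have *: "slot t / 2 ^ (rk t + 2) \<le> slot t' / 2 ^ (rk t' + 2)"
    "slot t' / 2 ^ (rk t' + 2) < (slot t + 1) / 2 ^ (rk t + 2)"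
    using t t' by (simp_all only:)
  have "slot t' / 2 ^ (rk t' + 2) < (slot t' + 1) / 2 ^ (rk t' + 2)"
    by (intro divide_strict_right_mono) auto
  then show "t = t'"
    using * sep[of t t'] sep[of t' t] t(1) t'(1) assms(7) by (cases t t' rule: linorder_cases) auto
  then show "p = q" using t(2) t'(2) r by simp
qed

lemma coding_theorem:
  assumes "kp_optimal V"
  shows "\<exists>c. \<forall>x y k. (1/2) ^ k < outp (enc x) (enc y) \<longrightarrow> KP V y x \<le> k + c"
proof -
  \<comment> \<open>The numerical test says that \<open>e\<close> codes a string of length
    \<open>rk t + 2\<close> whose \<open>msb\<close> is \<open>slot t\<close>.\<close>
  define G where "G t e x = (if issued heavy t \<and> rx t = x \<and> 2 ^ (rk t + 2) \<le> Suc e \<and> Suc e < 2 ^ Suc (rk t + 2) \<and>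
      (\<Sum>i<rk t + 2. (Suc e - 2 ^ (rk t + 2)) div 2 ^ i mod 2 * 2 ^ (rk t + 2 - 1 - i)) = slot t
    then Suc (ry t) else 0)" for t e x
  have G: "G t (enc p) x = Suc y \<longleftrightarrow>
      issued heavy t \<and> rx t = x \<and> length p = rk t + 2 \<and> msb p = slot t \<and> ry t = y" for t p x y
    unfolding G_def using msb_eq_sum[of p "rk t + 2"] length_iff_enc[of p "rk t + 2"] by auto
  note di = decidable_issued[OF decidable_heavy]
  have "recursive offset"
    unfolding offset_def by (intro recursive_intros di)
  then have slot: "recursive slot"
    unfolding slot_def by (intro recursive_intros)
  have "recursive3 G"
    unfolding recursive3_def G_def by (intro recursive_intros di recursive_comp[OF slot])
  moreover have "p = q \<and> y = y'"
    if "G s (enc p) x = Suc y" "G s' (enc q) x = Suc y'" "prefix p q" for p q s s' x y y'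
    using that slot_prefix[of s p s' q] unfolding G by auto
  ultimately have "\<exists>W. prefix_free2 W \<and> computable2 W \<and>
      (\<forall>p x y. W p x = Some y \<longleftrightarrow> (\<exists>s. G s (enc p) (enc x) = Suc (enc y)))"
    by (rule machine_from_enumeration)
  then obtain W where W: "prefix_free2 W" "computable2 W"
    "\<And>p x y. W p x = Some y \<longleftrightarrow> (\<exists>s. G s (enc p) (enc x) = Suc (enc y))"
    by blast
  obtain c where c: "\<And>p x y. W p x = Some y \<Longrightarrow> \<exists>q. V q x = Some y \<and> length q \<le> length p + c"
    using assms W(1,2) unfolding kp_optimal_def by blast
  \<comment> \<open>The 2 is the extra program length for fitting a dyadic interval;
    \<open>c\<close> is the cost of passing from \<open>W\<close> to \<open>V\<close>.\<close>
  have "KP V y x \<le> k + (2 + c)" if "(1/2) ^ k < outp (enc x) (enc y)" for x y k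
  proof -
    obtain s where "heavy (enc x) (enc y) k s" using outp_imp_heavy \<open>(1/2) ^ k < outp _ _\<close> by blast
    then obtain t where t: "issued heavy t" "rx t = enc x" "ry t = enc y" "rk t = k"
      by (rule issued_exists)
    have "(slot t + 1) / 2 ^ (rk t + 2) \<le> 1"
      using slot_bounds(2)[of t] right_end_le[OF t(1)] by linarith
    then have "real (slot t + 1) \<le> real (2 ^ (rk t + 2))" by (simp add: divide_le_eq)
    then have "slot t < 2 ^ (rk t + 2)" by (simp only: of_nat_le_iff)
    then obtain p where p: "length p = rk t + 2" "msb p = slot t" using msb_surj by blast
    then have "W p x = Some y" using t G W(3) by blast
    then obtain q where "V q x = Some y" "length q \<le> length p + c" using c by blast
    then show ?thesis using KP_le[of V q x y] p(1) t(4) by simp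
  qed
  then show ?thesis by blast
qed

end

section \<open>Joint allocation\<close>

text \<open>The inner sum is the rank of \<open>N\<close> among the elements satisfying
  \<open>P\<close>; bounding it by \<open>k\<close> selects the first \<open>k\<close> of
  them.\<close>

lemma card_first_elements:
  fixes P :: "nat \<Rightarrow> bool"
  shows "card {N. N < n \<and> P N \<and> (\<Sum>M<N. of_bool (P M)) < (k::nat)} = min k (\<Sum>N<n. of_bool (P N))"
proof (induction n)
  case (Suc n)
  let ?A = "\<lambda>n. {N. N < n \<and> P N \<and> (\<Sum>M<N. of_bool (P M)) < k}"
  show ?case
  proof (cases "P n \<and> (\<Sum>M<n. of_bool (P M)) < k")
    case True
    then have "?A (Suc n) = insert n (?A n)" by (auto simp: less_Suc_eq)
    then have "card (?A (Suc n)) = Suc (card (?A n))" by simp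
    with True Suc.IH show ?thesis by simp
  next
    case False
    then have "?A (Suc n) = ?A n" by (auto simp: less_Suc_eq)
    then have "card (?A (Suc n)) = min k (\<Sum>N<n. of_bool (P N))" using Suc.IH by (simp only:)
    also have "\<dots> = min k (\<Sum>N<Suc n. of_bool (P N))"
      using False by (cases "P n") (simp_all add: min_def)
    finally show ?thesis .
  qed
qed simp

text \<open>Counts the extensions by \<open>b\<close> bits of the strings of length \<open>a\<close>
  in \<open>A\<close>: the residue is the prefix and the quotient is the rest.\<close>

lemma card_mod_preimage_le:
  fixes A :: "nat set"
  assumes "finite A"
  shows "card {N. N < 2 ^ (a + b) \<and> N mod 2 ^ a \<in> A} \<le> card A * 2 ^ b"
proof -
  let ?S = "{N. N < 2 ^ (a + b) \<and> N mod 2 ^ a \<in> A}"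
  let ?f = "\<lambda>N::nat. (N mod 2 ^ a, N div 2 ^ a)"
  have "inj_on ?f ?S" by (rule inj_onI) (metis div_mult_mod_eq prod.inject)
  moreover have "?f ` ?S \<subseteq> A \<times> {..<2 ^ b}"
    by (auto simp: power_add less_mult_imp_div_less mult.commute)
  ultimately have "card ?S \<le> card (A \<times> {..<(2::nat) ^ b})"
    using assms by (intro card_inj_on_le) auto
  then show ?thesis by (simp add: card_cartesian_product)
qed

lemma Suc_enc: "Suc (enc p) = 2 ^ length p + bval ((!) p) (length p)"
  using Suc_enc_map_upt[of "(!) p" "length p"] by (simp add: map_nth)

lemma bval_prefix:
  assumes "prefix p q"
  shows "bval ((!) q) (length q) mod 2 ^ length p = bval ((!) p) (length p)"
proof -
  have "length p \<le> length q" using assms by (rule prefix_length_le)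
  then have "bval ((!) q) (length q) mod 2 ^ length p = bval ((!) q) (length p)" by (rule bval_mod)
  also have "\<dots> = bval ((!) p) (length p)"
    using assms unfolding bval_def by (intro sum.cong) (auto simp: prefix_def nth_append)
  finally show ?thesis .
qed

lemma sum_Un_le:
  fixes f :: "'a \<Rightarrow> real"
  assumes "finite A" "finite B" "\<And>a. 0 \<le> f a"
  shows "sum f (A \<union> B) \<le> sum f A + sum f B"
  using assms by (simp add: sum_Un sum_nonneg)

context clocked_machine
begin

definition mutual :: "nat \<Rightarrow> nat \<Rightarrow> nat \<Rightarrow> nat \<Rightarrow> bool" where
  "mutual x y k s \<longleftrightarrow> heavy x y k s \<and> heavy y x k s"

definition clash :: "nat \<Rightarrow> nat \<Rightarrow> bool" where
  "clash t' t \<longleftrightarrow> issued mutual t' \<and>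
    ((rx t' = rx t \<or> rx t' = ry t) \<or> (ry t' = rx t \<or> ry t' = ry t))"

text \<open>A table \<open>H\<close> is the binary code of the finite set of all pairs \<open>(t', N)\<close> for which the string of
  length \<open>t' + 4\<close> and value \<open>N\<close> has been allocated at stage \<open>t'\<close>.\<close>

definition vacant :: "nat \<Rightarrow> nat \<Rightarrow> nat \<Rightarrow> bool" where
  "vacant H t N \<longleftrightarrow>
    (\<forall>t'<t. \<not> (clash t' t \<and> H div 2 ^ prod_encode (t', N mod 2 ^ (t' + 4)) mod 2 = 1))"

text \<open>Greedy choice of the first \<open>2 ^ (t - rk t)\<close> vacant strings; among strings
  of length \<open>t + 4\<close> that number has measure \<open>2^-(rk t + 4)\<close>.\<close>

definition chosen :: "nat \<Rightarrow> nat \<Rightarrow> nat \<Rightarrow> bool" where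
  "chosen H t N \<longleftrightarrow> issued mutual t \<and> vacant H t N \<and> (\<Sum>M<N. of_bool (vacant H t M)) < (2::nat) ^ (t - rk t)"

definition extend :: "nat \<Rightarrow> nat \<Rightarrow> nat" where
  "extend t H = H + (\<Sum>N<2 ^ (t + 4). if chosen H t N then 2 ^ prod_encode (t, N) else 0)"

definition table :: "nat \<Rightarrow> nat" where
  "table t = rec_nat 0 extend t"

definition alloc :: "nat \<Rightarrow> nat set" where
  "alloc t = {N. N < 2 ^ (t + 4) \<and> chosen (table t) t N}"

lemma finite_alloc: "finite (alloc t)"
  by (simp add: alloc_def)

text \<open>Adding codes takes unions because the pairs entered at stage \<open>t\<close> have first
  component \<open>t\<close> and are therefore new.\<close>

lemma table_eq: "table t = set_encode (\<Union>t'<t. (\<lambda>N. prod_encode (t', N)) ` alloc t')"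
proof (induction t)
  case 0
  show ?case by (simp add: table_def)
next
  case (Suc t)
  let ?S = "\<Union>t'<t. (\<lambda>N. prod_encode (t', N)) ` alloc t'"
  let ?A = "(\<lambda>N. prod_encode (t, N)) ` alloc t"
  have "table (Suc t) = table t + (\<Sum>N<2 ^ (t + 4). if chosen (table t) t N then 2 ^ prod_encode (t, N) else 0)"
    by (simp add: table_def extend_def)
  also have "(\<Sum>N<2 ^ (t + 4). if chosen (table t) t N then 2 ^ prod_encode (t, N) else 0) =
      (\<Sum>N\<in>alloc t. 2 ^ prod_encode (t, N))"
    by (simp add: alloc_def sum.If_cases Int_def del: power_Suc)
  also have "\<dots> = set_encode ?A"
    by (simp add: set_encode_def sum.reindex inj_on_def)
  also have "table t + set_encode ?A = set_encode (?S \<union> ?A)"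
    unfolding Suc.IH set_encode_def
    by (rule sum.union_disjoint[symmetric]) (auto simp: finite_alloc)
  finally show ?case by (simp add: lessThan_Suc Un_commute)
qed

lemma vacant_table: "vacant (table t) t N \<longleftrightarrow> (\<forall>t'<t. clash t' t \<longrightarrow> N mod 2 ^ (t' + 4) \<notin> alloc t')"
proof -
  have "set_decode (table t) = (\<Union>t'<t. (\<lambda>N. prod_encode (t', N)) ` alloc t')"
    unfolding table_eq by (rule set_encode_inverse) (simp add: finite_alloc)
  then have "table t div 2 ^ prod_encode (t', M) mod 2 = 1 \<longleftrightarrow> M \<in> alloc t'" if "t' < t" for t' M
    using that by (auto simp: set_decode_def set_eq_iff odd_iff_mod_2_eq_one)
  then show ?thesis unfolding vacant_def by blast
qed

lemma card_alloc_eq: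
  assumes "issued mutual t"
  shows "card (alloc t) = min (2 ^ (t - rk t)) (\<Sum>N<2 ^ (t + 4). of_bool (vacant (table t) t N))"
  using assms card_first_elements[of "2 ^ (t + 4)" "vacant (table t) t" "2 ^ (t - rk t)"]
  by (simp add: alloc_def chosen_def)

lemma card_alloc_le: "card (alloc t) \<le> 2 ^ (t - rk t)"
proof (cases "issued mutual t")
  case True
  then show ?thesis by (simp add: card_alloc_eq)
next
  case False
  then show ?thesis by (simp add: alloc_def chosen_def)
qed

text \<open>Either component of \<open>t'\<close> may equal either component of \<open>t\<close>;
  each of the four families has weight at most 2.\<close>

lemma sum_clash_le: "(\<Sum>t' | t' < t \<and> clash t' t. (1/2::real) ^ rk t') \<le> 8"
proof -
  let ?w = "\<lambda>t'. (1/2::real) ^ rk t'"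
  let ?X = "\<lambda>v. {t'. t' < t \<and> issued mutual t' \<and> rx t' = v}"
  let ?Y = "\<lambda>v. {t'. t' < t \<and> issued mutual t' \<and> ry t' = v}"
  have X: "sum ?w (?X v) \<le> 2" for v
    by (rule sum_issued_rx_le[where Q = mutual and v = v and m = "outp v"])
      (use heavy_imp_outp outp_nonneg sum_outp_le in \<open>auto simp: mutual_def\<close>)
  have Y: "sum ?w (?Y v) \<le> 2" for v
    by (rule sum_issued_ry_le[where Q = mutual and v = v and m = "outp v"])
      (use heavy_imp_outp outp_nonneg sum_outp_le in \<open>auto simp: mutual_def\<close>)
  have "{t'. t' < t \<and> clash t' t} = (?X (rx t) \<union> ?X (ry t)) \<union> (?Y (rx t) \<union> ?Y (ry t))"
    by (auto simp: clash_def)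
  moreover have "sum ?w ((?X (rx t) \<union> ?X (ry t)) \<union> (?Y (rx t) \<union> ?Y (ry t))) \<le>
      sum ?w (?X (rx t) \<union> ?X (ry t)) + sum ?w (?Y (rx t) \<union> ?Y (ry t))"
    by (rule sum_Un_le) auto
  moreover have "sum ?w (?X (rx t) \<union> ?X (ry t)) \<le> sum ?w (?X (rx t)) + sum ?w (?X (ry t))"
    by (rule sum_Un_le) auto
  moreover have "sum ?w (?Y (rx t) \<union> ?Y (ry t)) \<le> sum ?w (?Y (rx t)) + sum ?w (?Y (ry t))"
    by (rule sum_Un_le) auto
  ultimately show ?thesis using X[of "rx t"] X[of "ry t"] Y[of "rx t"] Y[of "ry t"] by simp
qed

text \<open>Earlier stages that share an endpoint with stage \<open>t\<close> block at most half of the strings, since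
  \<open>8 = 2^4 / 2\<close>.\<close>

lemma card_alloc:
  assumes "issued mutual t"
  shows "card (alloc t) = 2 ^ (t - rk t)"
proof -
  let ?n = "2 ^ (t + 4) :: nat"
  let ?v = "\<lambda>N. vacant (table t) t N"
  let ?C = "{t'. t' < t \<and> clash t' t}"
  let ?B = "\<lambda>t'. {N. N < ?n \<and> N mod 2 ^ (t' + 4) \<in> alloc t'}"
  have "{N. N < ?n \<and> \<not> ?v N} \<subseteq> (\<Union>t'\<in>?C. ?B t')"
    unfolding vacant_table by auto
  then have "card {N. N < ?n \<and> \<not> ?v N} \<le> card (\<Union>t'\<in>?C. ?B t')"
    by (intro card_mono) auto
  also have "\<dots> \<le> (\<Sum>t'\<in>?C. card (?B t'))" by (rule card_UN_le) simp
  finally have "real (card {N. N < ?n \<and> \<not> ?v N}) \<le> (\<Sum>t'\<in>?C. real (card (?B t')))"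
    unfolding of_nat_sum[symmetric] of_nat_le_iff .
  also have "\<dots> \<le> (\<Sum>t'\<in>?C. (1/2) ^ rk t' * 2 ^ t)"
  proof (rule sum_mono)
    fix t' assume "t' \<in> ?C"
    then have le: "t' \<le> t" by simp
    \<comment> \<open>Each string of length \<open>t' + 4\<close> has \<open>2 ^ (t - t')\<close>
      extensions of length \<open>t + 4\<close>.\<close>
    have "card (?B t') \<le> card (alloc t') * 2 ^ (t - t')"
      using card_mod_preimage_le[OF finite_alloc, of "t' + 4" "t - t'" t'] le by (simp add: add.commute)
    also have "\<dots> \<le> 2 ^ (t' - rk t') * 2 ^ (t - t')" using card_alloc_le by simp
    also have "\<dots> = 2 ^ (t - rk t')"
      using le rk_le[of t'] by (simp flip: power_add)
    finally have "real (card (?B t')) \<le> 2 ^ (t - rk t')" by (metis of_nat_le_iff of_nat_numeral of_nat_power)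
    also have "\<dots> = (1/2) ^ rk t' * 2 ^ t"
      using le rk_le[of t'] by (simp add: power_diff power_divide)
    finally show "real (card (?B t')) \<le> (1/2) ^ rk t' * 2 ^ t" .
  qed
  also have "\<dots> = (\<Sum>t'\<in>?C. (1/2) ^ rk t') * 2 ^ t" by (rule sum_distrib_right[symmetric])
  also have "\<dots> \<le> 8 * 2 ^ t" by (intro mult_right_mono sum_clash_le) simp
  finally have "real (card {N. N < ?n \<and> \<not> ?v N}) \<le> real (8 * 2 ^ t)" by simp
  then have nonvacant: "card {N. N < ?n \<and> \<not> ?v N} \<le> 8 * 2 ^ t" by (simp only: of_nat_le_iff)
  have "{..<?n} = {N. N < ?n \<and> ?v N} \<union> {N. N < ?n \<and> \<not> ?v N}" by auto
  then have "?n = card ({N. N < ?n \<and> ?v N} \<union> {N. N < ?n \<and> \<not> ?v N})" by (metis card_lessThan)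
  also have "\<dots> = card {N. N < ?n \<and> ?v N} + card {N. N < ?n \<and> \<not> ?v N}"
    by (rule card_Un_disjoint) auto
  finally have "8 * 2 ^ t \<le> card {N. N < ?n \<and> ?v N}" using nonvacant by (simp add: power_add)
  moreover have "card {N. N < ?n \<and> ?v N} = (\<Sum>N<?n. of_bool (?v N))"
    by (simp add: of_bool_def sum.If_cases Int_def)
  \<comment> \<open>At least \<open>8 * 2 ^ t\<close> strings are vacant, so the minimum in
    \<open>card_alloc_eq\<close> is the requested number.\<close>
  moreover have "(2::nat) ^ (t - rk t) \<le> 8 * 2 ^ t"
  proof -
    have "(2::nat) ^ (t - rk t) \<le> 2 ^ t" by (rule power_increasing) simp_all
    then show ?thesis by linarith
  qed
  ultimately show ?thesis unfolding card_alloc_eq[OF assms] by linarith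
qed

text \<open>Programs declared for the same input at two stages come from requests sharing an
  endpoint, so the later ones avoid all extensions of the earlier ones. Program length is the stage
  number plus 4, hence a prefix never comes from a later stage.\<close>

lemma joint_machine:
  "\<exists>W. prefix_free2 W \<and> computable2 W \<and> (\<forall>t x y. issued mutual t \<and> rx t = enc x \<and> ry t = enc y \<longrightarrow>
    (\<forall>p. length p = t + 4 \<and> bval ((!) p) (t + 4) \<in> alloc t \<longrightarrow> W p x = Some y \<and> W p y = Some x))"
proof -
  define G where "G t e v = (if 2 ^ (t + 4) \<le> Suc e \<and> Suc e < 2 ^ Suc (t + 4) \<and>
      chosen (table t) t (Suc e - 2 ^ (t + 4)) then
        (if v = rx t then Suc (ry t) else if v = ry t then Suc (rx t) else 0) else 0)" for t e v
  have G: "G t (enc p) v = Suc y \<longleftrightarrow> length p = t + 4 \<and> bval ((!) p) (t + 4) \<in> alloc t \<and>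
      (v = rx t \<and> y = ry t \<or> v = ry t \<and> y = rx t)" for t p v y
  proof (cases "length p = t + 4")
    case True
    then have "2 ^ (t + 4) \<le> Suc (enc p) \<and> Suc (enc p) < 2 ^ Suc (t + 4)" using length_iff_enc by blast
    moreover have "Suc (enc p) - 2 ^ (t + 4) = bval ((!) p) (t + 4)" using Suc_enc[of p] True by simp
    ultimately show ?thesis unfolding G_def alloc_def using True bval_less by auto
  next
    case False
    then show ?thesis unfolding G_def length_iff_enc[of p "t + 4"] by auto
  qed
  have dm: "decidable (\<lambda>z. mutual (a z) (b z) (c z) (d z))"
    if "recursive a" "recursive b" "recursive c" "recursive d" for a b c d
    unfolding mutual_def using that by (intro decidable_conj decidable_heavy)
  note di = decidable_issued[OF dm]
  have ext: "recursive (\<lambda>z. extend (pfst z) (pfst (psnd z)))"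
    unfolding extend_def chosen_def vacant_def clash_def by (intro recursive_intros di)
  have table: "recursive table"
    unfolding table_def[abs_def] by (intro recursive_intros ext)
  have "recursive3 G"
    unfolding recursive3_def G_def chosen_def vacant_def clash_def
    by (intro recursive_intros di recursive_comp[OF table])
  moreover have "p = q \<and> y = y'"
    if p: "G s (enc p) v = Suc y" and q: "G s' (enc q) v = Suc y'" and "prefix p q" for p q s s' v y y'
  proof -
    have lp: "length p = s + 4" "bval ((!) p) (s + 4) \<in> alloc s" using p unfolding G by auto
    have lq: "length q = s' + 4" "bval ((!) q) (s' + 4) \<in> alloc s'" using q unfolding G by auto
    have "\<not> s < s'"
    proof
      assume "s < s'"
      have "issued mutual s" using lp(2) by (simp add: alloc_def chosen_def)
      moreover have "v = rx s \<or> v = ry s" "v = rx s' \<or> v = ry s'" using p q unfolding G by blast+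
      ultimately have "clash s s'" unfolding clash_def by blast
      moreover have "vacant (table s') s' (bval ((!) q) (s' + 4))"
        using lq(2) by (simp add: alloc_def chosen_def)
      ultimately have "bval ((!) q) (s' + 4) mod 2 ^ (s + 4) \<notin> alloc s"
        using \<open>s < s'\<close> unfolding vacant_table by blast
      then show False using bval_prefix[OF \<open>prefix p q\<close>] lp lq by simp
    qed
    moreover have "s \<le> s'" using prefix_length_le[OF \<open>prefix p q\<close>] lp lq by simp
    ultimately have "s = s'" by simp
    then have "p = q" using \<open>prefix p q\<close> lp lq by (auto simp: prefix_def)
    with p q \<open>s = s'\<close> show ?thesis by simp
  qed
  ultimately have "\<exists>W. prefix_free2 W \<and> computable2 W \<and>
      (\<forall>p x y. W p x = Some y \<longleftrightarrow> (\<exists>s. G s (enc p) (enc x) = Suc (enc y)))"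
    by (rule machine_from_enumeration)
  then show ?thesis unfolding G by metis
qed

end

section \<open>Measurability and the probability bounds\<close>

lemma computable2_clocked_machine:
  assumes "prefix_free2 U" "computable2 U"
  obtains T where "clocked_machine U T"
proof -
  obtain T where "recursive3 T" "\<And>s s' e x y. T s e x = Suc y \<Longrightarrow> s \<le> s' \<Longrightarrow> T s' e x = Suc y"
    "\<And>p x y. U p x = Some y \<longleftrightarrow> (\<exists>s. T s (enc p) (enc x) = Suc (enc y))"
    using computable2_clocked[OF assms(2)] by metis
  then have "clocked_machine U T" using assms(1) by unfold_locales
  then show ?thesis by (rule that)
qed

lemma sets_runs:
  assumes "prefix_free2 W" "computable2 W"
  shows "{\<pi>. runs W \<pi> x y} \<in> sets cantor"
proof -
  obtain T where "clocked_machine W T" using assms by (rule computable2_clocked_machine)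
  then interpret clocked_machine W T .
  show ?thesis using sets_outp[of "enc x" "enc y"] by (simp add: runs_iff_hit)
qed

context clocked_machine
begin

lemma joint_probability:
  "\<exists>W. prefix_free2 W \<and> computable2 W \<and> (\<forall>x y k.
    (1/2) ^ k < outp (enc x) (enc y) \<and> (1/2) ^ k < outp (enc y) (enc x) \<longrightarrow> (1/2) ^ (k + 4) \<le> eprob W x y)"
proof -
  interpret prob_space cantor by (rule prob_space_cantor)
  obtain W where W: "prefix_free2 W" "computable2 W"
    and prog: "\<And>t x y p. issued mutual t \<Longrightarrow> rx t = enc x \<Longrightarrow> ry t = enc y \<Longrightarrow> length p = t + 4 \<Longrightarrow>
      bval ((!) p) (t + 4) \<in> alloc t \<Longrightarrow> W p x = Some y \<and> W p y = Some x"
    using joint_machine by blast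
  have "(1/2) ^ (k + 4) \<le> eprob W x y"
    if xy: "(1/2) ^ k < outp (enc x) (enc y)" and yx: "(1/2) ^ k < outp (enc y) (enc x)" for x y k
  proof -
    \<comment> \<open>\<open>mutual\<close> asks for both observations at one time; persistence
      supplies \<open>max s1 s2\<close>.\<close>
    obtain s1 s2 where "\<forall>s\<ge>s1. heavy (enc x) (enc y) k s" "\<forall>s\<ge>s2. heavy (enc y) (enc x) k s"
      using outp_imp_heavy[OF xy] outp_imp_heavy[OF yx] by blast
    then have "mutual (enc x) (enc y) k (max s1 s2)" by (simp add: mutual_def)
    then obtain t where t: "issued mutual t" "rx t = enc x" "ry t = enc y" "rk t = k"
      by (rule issued_exists)
    let ?E = "{\<pi>. bval \<pi> (t + 4) \<in> alloc t}"
    have "?E \<subseteq> {\<pi>. runs W \<pi> x y \<and> runs W \<pi> y x}"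
    proof safe
      fix \<pi> assume \<pi>: "bval \<pi> (t + 4) \<in> alloc t"
      have "bval ((!) (map \<pi> [0..<t + 4])) (t + 4) = bval \<pi> (t + 4)"
        unfolding bval_def by (intro sum.cong) auto
      then have "W (map \<pi> [0..<t + 4]) x = Some y \<and> W (map \<pi> [0..<t + 4]) y = Some x"
        using prog[OF t(1-3), of "map \<pi> [0..<t + 4]"] \<pi> by simp
      then show "runs W \<pi> x y" "runs W \<pi> y x" unfolding runs_def by blast+
    qed
    moreover have "{\<pi>. runs W \<pi> x y \<and> runs W \<pi> y x} \<in> sets cantor"
      using sets.Int[OF sets_runs[OF W, of x y] sets_runs[OF W, of y x]] by (simp add: Int_def)
    ultimately have "measure cantor ?E \<le> eprob W x y"
      unfolding eprob_def by (simp add: finite_measure_mono)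
    moreover have "measure cantor ?E = card (alloc t) / 2 ^ (t + 4)"
      by (rule measure_cantor_bval) (auto simp: alloc_def)
    moreover have "card (alloc t) / 2 ^ (t + 4) = (1/2 :: real) ^ (k + 4)"
    proof -
      have "t + 4 = (t - k) + (k + 4)" using rk_le[of t] t(4) by simp
      then have "(2::real) ^ (t + 4) = 2 ^ (t - k) * 2 ^ (k + 4)" by (metis power_add)
      then show ?thesis unfolding card_alloc[OF t(1)] t(4) by (simp add: power_one_over)
    qed
    ultimately show ?thesis by simp
  qed
  with W show ?thesis by blast
qed

lemma outp_ge_program:
  assumes "U p x = Some y"
  shows "(1/2) ^ length p \<le> outp (enc x) (enc y)"
proof -
  interpret prob_space cantor by (rule prob_space_cantor)
  have "{\<pi>. map \<pi> [0..<length p] = p} \<subseteq> {\<pi>. runs U \<pi> x y}"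
    using assms unfolding runs_def by (metis (mono_tags, lifting) Collect_mono)
  then have "measure cantor {\<pi>. map \<pi> [0..<length p] = p} \<le> outp (enc x) (enc y)"
    unfolding outp_runs using sets_outp[of "enc x" "enc y"]
    by (intro finite_measure_mono) (simp_all add: runs_iff_hit)
  then show ?thesis by (simp add: measure_cantor_cylinder)
qed

lemma eprob_le_outp: "eprob U x y \<le> outp (enc x) (enc y)" "eprob U x y \<le> outp (enc y) (enc x)"
proof -
  interpret prob_space cantor by (rule prob_space_cantor)
  show "eprob U x y \<le> outp (enc x) (enc y)" "eprob U x y \<le> outp (enc y) (enc x)"
    unfolding eprob_def outp_def using sets_outp
    by (auto simp: runs_iff_hit intro!: finite_measure_mono)
qed

end

section \<open>Combination of the two inequalities\<close>

theorem theorem3: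
  fixes U V :: "bool list \<Rightarrow> bool list \<Rightarrow> bool list option"
  assumes "e_optimal U" and "kp_optimal V"
  shows "\<exists>c::real. \<forall>x y.
    \<bar>- log 2 (eprob U x y) - real (max (KP V x y) (KP V y x))\<bar> \<le> c"
proof -
  have "prefix_free2 U" "computable2 U" "prefix_free2 V" "computable2 V"
    using assms by (simp_all add: e_optimal_def kp_optimal_def)
  then obtain T T' where T: "clocked_machine U T" "clocked_machine V T'"
    using computable2_clocked_machine by metis
  \<comment> \<open>The coding theorem is applied to the output probabilities of \<open>U\<close>,
    the joint allocation to those of \<open>V\<close>.\<close>
  interpret U: clocked_machine U T by (rule T(1))
  interpret V: clocked_machine V T' by (rule T(2))
  obtain W where W: "prefix_free2 W" "computable2 W"
    and W_ge: "\<And>x y k. (1/2) ^ k < V.outp (enc x) (enc y) \<Longrightarrow> (1/2) ^ k < V.outp (enc y) (enc x) \<Longrightarrow>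
      (1/2) ^ (k + 4) \<le> eprob W x y"
    using V.joint_probability by blast
  obtain a where a: "a > 0" "\<And>x y. eprob W x y \<le> a * eprob U x y"
    using assms(1) W unfolding e_optimal_def by blast
  obtain c where c: "\<And>x y k. (1/2) ^ k < U.outp (enc x) (enc y) \<Longrightarrow> KP V y x \<le> k + c"
    using U.coding_theorem[OF assms(2)] by blast
  \<comment> \<open>One direction costs \<open>5 + log 2 a\<close>: 4 from the allocation, 1 from
    \<open>Suc K\<close>, the rest from optimality of \<open>U\<close>. The other costs
    \<open>1 + c\<close>, with 1 for rounding to an integer. Their sum covers both.\<close>
  have "\<bar>- log 2 (eprob U x y) - real (max (KP V x y) (KP V y x))\<bar> \<le> 5 + \<bar>log 2 a\<bar> + 1 + real c" for x y
  proof -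
    define K where "K = max (KP V x y) (KP V y x)"
    define e where "e = eprob U x y"
    \<comment> \<open>\<open>Suc K\<close> turns the weak bound given by a program of length at most
      \<open>K\<close> into the strict one that \<open>W_ge\<close> requires.\<close>
    have V_outp: "(1/2) ^ Suc K < V.outp (enc u) (enc v)" if "KP V v u \<le> K" for u v
    proof -
      obtain p where p: "length p = KP V v u" "V p u = Some v" using KP_program[OF assms(2)] by blast
      have "(1/2::real) ^ Suc K < (1/2) ^ length p" using that p(1) by (intro power_strict_decreasing) auto
      also have "\<dots> \<le> V.outp (enc u) (enc v)" by (rule V.outp_ge_program[OF p(2)])
      finally show ?thesis .
    qed
    have "(1/2) ^ (Suc K + 4) \<le> eprob W x y"
      by (rule W_ge; rule V_outp) (simp_all add: K_def)
    also have "\<dots> \<le> a * e" using a(2) e_def by simp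
    finally have lower: "(1/2) ^ (Suc K + 4) \<le> a * e" .
    have "0 < (1/2::real) ^ (Suc K + 4)" by simp
    with lower a(1) have e_pos: "0 < e" by (metis less_le_trans zero_less_mult_pos)
    have "log 2 ((1/2) ^ (Suc K + 4)) \<le> log 2 (a * e)"
      using lower \<open>0 < (1/2::real) ^ (Suc K + 4)\<close> by (intro log_mono) auto
    then have "- real (Suc K + 4) \<le> log 2 a + log 2 e"
      using a(1) e_pos by (simp only: log_nat_power log_mult_pos) (simp add: log_divide)
    then have 1: "- log 2 e - K \<le> 5 + log 2 a" by simp
    have "e \<le> 1" unfolding e_def eprob_def using prob_space_cantor by (simp add: prob_space.prob_le_1)
    then have "0 \<le> - log 2 e" using e_pos by simp
    \<comment> \<open>The least natural number strictly above \<open>- log 2 e\<close>, as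
      \<open>coding_theorem\<close> needs a strict inequality.\<close>
    define k where "k = Suc (nat \<lfloor>- log 2 e\<rfloor>)"
    have k: "- log 2 e < k" "k \<le> - log 2 e + 1"
      using \<open>0 \<le> - log 2 e\<close> unfolding k_def by linarith+
    have "(1/2) ^ k = 2 powr (- real k)" by (simp add: powr_minus_divide powr_realpow power_one_over)
    also have "\<dots> < 2 powr (log 2 e)" using k(1) by simp
    also have "\<dots> = e" using e_pos by simp
    finally have "(1/2) ^ k < e" .
    then have "KP V y x \<le> k + c" "KP V x y \<le> k + c"
      using c U.eprob_le_outp[of x y] e_def by (meson less_le_trans)+
    then have "K \<le> k + c" by (simp add: K_def)
    then have "real K \<le> real k + real c" by linarith
    with 1 k(2) show ?thesis unfolding K_def[symmetric] e_def[symmetric] by linarith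
  qed
  then show ?thesis by blast
qed

end
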